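(* Let $S\ge 1$ and $p\ge 1$ be integers and let $\{Y_t,t\in\mathbb{Z}\}$ be the (periodically stationary) process defined by $$\phi_t(L)(1-L^S)^{D_t}Y_t=u_t,\qquad t\in\mathbb{Z},$$ in the setting described in the context, in particular with $0\le D_s<\tfrac12$ for $s=1,\dots,S$ and with the stated root condition on the autoregressive part. Let $\gamma^{(s)}(j)=\mathrm{Cov}(Y_{S\tau+s},Y_{S\tau+s+j})$ for $s\in\{1,\dots,S\}$ and integers $j>0$. Write $j=hS+\nu$ with integers $h\ge 0$ and $0\le\nu\le S-1$, and put $\delta=0$ if $1\le s+\nu\le S$ and $\delta=1$ if $S+1\le s+\nu\le 2S-1$. Then, for every fixed $s\in\{1,\dots,S\}$ and $\nu\in\{0,\dots,S-1\}$, as $h\to\infty$ (that is, as $j=hS+\nu\to\infty$), $$\gamma^{(s)}(j)\sim (h+\delta)^{D_s+D_{s+\nu-S\delta}-1}\left[\frac{\Gamma(1-D_s-D_{s+\nu-S\delta})}{\Gamma(D_{s+\nu-S\delta})\,\Gamma(1-D_{s+\nu-S\delta})}\right]\mathbf{\Pi}_s'\,\mathbf{\Omega}\,\mathbf{\Pi}_{s+\nu-S\delta},$$ where $\mathbf{\Pi}_s'$ denotes the $s$-th row of the matrix $\mathbf{\Pi}=[\mathbf{\Phi}(1)]^{-1}$ (and $\mathbf{\Pi}_s$ its transpose) and $\mathbf{\Omega}=\mathrm{diag}(\sigma_1^2,\dots,\sigma_S^2)$.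
   Context: $L$ is the lag operator, $LX_t=X_{t-1}$. $\{u_t,t\in\mathbb{Z}\}$ is a zero-mean white noise (pairwise uncorrelated variables) with variance $\mathrm{Var}(u_t)=\sigma_t^2$, where $\sigma_{t+S}^2=\sigma_t^2$. The fractional parameter $D_t\in\mathbb{R}$ is $S$-periodic in $t$. $\phi_t(L)=1-\phi_{t,1}L-\dots-\phi_{t,p}L^p$ with real coefficients $\phi_{t,i}$ that are $S$-periodic in $t$; set $\phi_{t,i}=0$ for $i>p$. The operator $(1-L^S)^{D_t}$ is defined by the binomial expansion $(1-L^S)^{D_t}X_t=\sum_{j\ge0}\frac{\Gamma(j-D_t)}{\Gamma(j+1)\Gamma(-D_t)}X_{t-Sj}$ (the identity if $D_t=0$). In $\phi_t(L)(1-L^S)^{D_t}Y_t$, one first forms $W_t=(1-L^S)^{D_t}Y_t$ for all $t$ and then applies $\phi_t(L)$ to $W_t$. $S$-variate form: put $\underline{\mathbf{Y}}_\tau=(Y_{1+S\tau},\dots,Y_{S+S\tau})'$ and $\underline{\mathbf{u}}_\tau=(u_{1+S\tau},\dots,u_{S+S\tau})'$, and let $L$ act on $\tau$ in these vectors. The model reads $\mathbf{\Phi}(L)\,\nabla^{\underline{\mathbf D}}(L)\,\underline{\mathbf{Y}}_\tau=\underline{\mathbf{u}}_\tau$, where $\nabla^{\underline{\mathbf D}}(L)=\mathrm{diag}((1-L)^{D_1},\dots,(1-L)^{D_S})$, $\mathbf{\Phi}(L)=\mathbf{\Phi}_0-\mathbf{\Phi}_1L-\dots-\mathbf{\Phi}_{\mathbf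 P}L^{\mathbf P}$, $\mathbf P=\lfloor (p+1)/S\rfloor+1$, and the $S\times S$ matrices are: $(\mathbf{\Phi}_0)_{s,k}=1$ if $s=k$, $0$ if $s<k$, $-\phi_{s,s-k}$ if $s>k$; and $(\mathbf{\Phi}_i)_{s,k}=\phi_{s,\,iS+s-k}$ for $1\le i\le\mathbf P$, $1\le s,k\le S$. Stationarity assumptions: all roots $z$ of $\det\big(I_Sz^{\mathbf P}-\sum_{i=1}^{\mathbf P}\mathbf{\Phi}_0^{-1}\mathbf{\Phi}_iz^{\mathbf P-i}\big)=0$ satisfy $|z|<1$, and $0\le D_s<\tfrac12$ for all $s=1,\dots,S$. Then $\mathbf{\Phi}(L)^{-1}=\sum_{j\ge0}\mathbf{\Pi}_jL^j$ with entrywise absolutely summable coefficient matrices, $\mathbf{\Pi}=[\mathbf{\Phi}(1)]^{-1}=\sum_{j\ge0}\mathbf{\Pi}_j$, and $\underline{\mathbf{Y}}_\tau$ is the stationary solution given by the mean-square convergent infinite moving average $\underline{\mathbf{Y}}_\tau=\nabla^{\underline{\mathbf D}}(L)^{-1}\mathbf{\Phi}(L)^{-1}\underline{\mathbf{u}}_\tau$, where $\nabla^{\underline{\mathbf D}}(L)^{-1}=\mathrm{diag}((1-L)^{-D_1},\dots,(1-L)^{-D_S})$ and $(1-L)^{-D}=\sum_{j\ge0}\frac{\Gamma(j+D)}{\Gamma(j+1)\Gamma(D)}L^j$ (the identity if $D=0$). Conventions: $1/\Gamma(0)=0$. The relation $a_h\sim (h+\delta)^{\alpha}c$ means $a_h/(h+\delta)^{\alpha}\to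 c$ as $h\to\infty$ (so that it is meaningful also when the constant $c$ is $0$). *)

theory Defs
  imports
    "HOL-Probability.Probability"
    "HOL-Computational_Algebra.Formal_Power_Series"
    "Jordan_Normal_Form.Determinant"
begin

definition square_integrable :: "'a measure \<Rightarrow> ('a \<Rightarrow> real) \<Rightarrow> bool" where
  "square_integrable M X \<longleftrightarrow> X \<in> borel_measurable M \<and> integrable M (\<lambda>\<omega>. (X \<omega>)\<^sup>2)"

definition covariance :: "'a measure \<Rightarrow> ('a \<Rightarrow> real) \<Rightarrow> ('a \<Rightarrow> real) \<Rightarrow> real" where
  "covariance M X Z =
     (LINT \<omega>|M. (X \<omega> - (LINT \<omega>'|M. X \<omega>')) * (Z \<omega> - (LINT \<omega>'|M. Z \<omega>')))"

text \<open>The square integrability clauses are essential: the integral of a non-integrable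
  function is 0, so the limit alone would not express mean-square convergence.\<close>

definition ms_sums :: "'a measure \<Rightarrow> (nat \<Rightarrow> 'a \<Rightarrow> real) \<Rightarrow> ('a \<Rightarrow> real) \<Rightarrow> bool" where
  "ms_sums M f Z \<longleftrightarrow>
     (\<forall>j. square_integrable M (f j)) \<and> square_integrable M Z \<and>
     (\<lambda>n. LINT \<omega>|M. ((\<Sum>j<n. f j \<omega>) - Z \<omega>)\<^sup>2) \<longlonglongrightarrow> 0"

definition white_noise :: "'a measure \<Rightarrow> (int \<Rightarrow> real) \<Rightarrow> (int \<Rightarrow> 'a \<Rightarrow> real) \<Rightarrow> bool" where
  "white_noise M \<sigma> u \<longleftrightarrow>
     (\<forall>t. square_integrable M (u t)) \<and>
     (\<forall>t. (LINT \<omega>|M. u t \<omega>) = 0) \<and>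
     (\<forall>t. prob_space.variance M (u t) = (\<sigma> t)\<^sup>2) \<and>
     (\<forall>t t'. t \<noteq> t' \<longrightarrow> covariance M (u t) (u t') = 0)"

definition periodic :: "nat \<Rightarrow> (int \<Rightarrow> 'b) \<Rightarrow> bool" where
  "periodic S f \<longleftrightarrow> (\<forall>t. f (t + int S) = f t)"

text \<open>The coefficient of \<open>x ^ j\<close> in the binomial expansion of \<open>(1 - x) powr d\<close>, for \<open>d\<close> not a
  positive integer (where the Gamma quotient is not meaningful).  The case \<open>d = 0\<close> has to be
  separated, since \<open>Gamma 0 = 0\<close> would make the coefficient at \<open>j = 0\<close> vanish.\<close>

definition frac_coeff :: "real \<Rightarrow> nat \<Rightarrow> real" where
  "frac_coeff d j =
     (if d = 0 then (if j = 0 then 1 else 0)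
      else Gamma (real j - d) / (Gamma (real j + 1) * Gamma (- d)))"

text \<open>The equation \<open>\<phi>\<^sub>t(L) (1 - L\<^sup>S)\<^bsup>D\<^sub>t\<^esup> Y\<^sub>t = u\<^sub>t\<close>: the fractional filter, a mean-square
  convergent series, is applied first and yields \<open>W\<close>.\<close>

definition model_equation ::
  "'a measure \<Rightarrow> nat \<Rightarrow> nat \<Rightarrow> (int \<Rightarrow> nat \<Rightarrow> real) \<Rightarrow> (int \<Rightarrow> real) \<Rightarrow>
   (int \<Rightarrow> 'a \<Rightarrow> real) \<Rightarrow> (int \<Rightarrow> 'a \<Rightarrow> real) \<Rightarrow> bool" where
  "model_equation M S p \<phi> D u Y \<longleftrightarrow>
     (\<exists>W :: int \<Rightarrow> 'a \<Rightarrow> real.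
        (\<forall>t. ms_sums M (\<lambda>j \<omega>. frac_coeff (D t) j * Y (t - int (S * j)) \<omega>) (W t)) \<and>
        (\<forall>t. AE \<omega> in M. W t \<omega> - (\<Sum>i=1..p. \<phi> t i * W (t - int i) \<omega>) = u t \<omega>))"

text \<open>Matrix indices start at 0, so season \<open>s \<in> {1..S}\<close> corresponds to index \<open>s - 1\<close>.\<close>

definition inv_mat :: "'b::comm_ring_1 mat \<Rightarrow> 'b mat" where
  "inv_mat A = (THE B. B \<in> carrier_mat (dim_row A) (dim_row A) \<and> inverts_mat A B \<and> inverts_mat B A)"

definition ar_order :: "nat \<Rightarrow> nat \<Rightarrow> nat" where
  "ar_order S p = (p + 1) div S + 1"

definition Phi0 :: "nat \<Rightarrow> (int \<Rightarrow> nat \<Rightarrow> real) \<Rightarrow> real mat" where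
  "Phi0 S \<phi> = Matrix.mat S S (\<lambda>(a, b).
     if a = b then 1 else if a < b then 0 else - \<phi> (int a + 1) (a - b))"

text \<open>Only used for \<open>i \<ge> 1\<close>, where the subtraction does not truncate.\<close>

definition Phi :: "nat \<Rightarrow> (int \<Rightarrow> nat \<Rightarrow> real) \<Rightarrow> nat \<Rightarrow> real mat" where
  "Phi S \<phi> i = Matrix.mat S S (\<lambda>(a, b). \<phi> (int a + 1) (i * S + a - b))"

text \<open>The lag operator \<open>L\<close> becomes the indeterminate of a formal power series, so that products
  and inverses of matrices of lag filters are those of matrices over the ring of power series.\<close>

definition Phi_lag :: "nat \<Rightarrow> nat \<Rightarrow> (int \<Rightarrow> nat \<Rightarrow> real) \<Rightarrow> real fps mat" where
  "Phi_lag S p \<phi> = Matrix.mat S S (\<lambda>(a, b).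
     fps_const (Phi0 S \<phi> $$ (a, b)) -
     (\<Sum>i=1..ar_order S p. fps_const (Phi S \<phi> i $$ (a, b)) * fps_X ^ i))"

definition Phi_at_one :: "nat \<Rightarrow> nat \<Rightarrow> (int \<Rightarrow> nat \<Rightarrow> real) \<Rightarrow> real mat" where
  "Phi_at_one S p \<phi> = Matrix.mat S S (\<lambda>(a, b).
     Phi0 S \<phi> $$ (a, b) - (\<Sum>i=1..ar_order S p. Phi S \<phi> i $$ (a, b)))"

definition root_condition :: "nat \<Rightarrow> nat \<Rightarrow> (int \<Rightarrow> nat \<Rightarrow> real) \<Rightarrow> bool" where
  "root_condition S p \<phi> \<longleftrightarrow>
     (\<forall>z::complex.
        Determinant.det (Matrix.mat S S (\<lambda>(a, b).
          (if a = b then z ^ ar_order S p else 0) -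
          (\<Sum>i=1..ar_order S p.
             complex_of_real ((inv_mat (Phi0 S \<phi>) * Phi S \<phi> i) $$ (a, b)) * z ^ (ar_order S p - i)))) = 0
        \<longrightarrow> cmod z < 1)"

definition nabla_inv_lag :: "nat \<Rightarrow> (int \<Rightarrow> real) \<Rightarrow> real fps mat" where
  "nabla_inv_lag S D = mat_diag S (\<lambda>a. Abs_fps (frac_coeff (- D (int a + 1))))"

text \<open>The moving average \<open>\<nabla>(L)\<inverse> \<Phi>(L)\<inverse> u\<^sub>\<tau>\<close>, read off componentwise.\<close>

definition ma_solution ::
  "'a measure \<Rightarrow> nat \<Rightarrow> nat \<Rightarrow> (int \<Rightarrow> nat \<Rightarrow> real) \<Rightarrow> (int \<Rightarrow> real) \<Rightarrow>
   (int \<Rightarrow> 'a \<Rightarrow> real) \<Rightarrow> (int \<Rightarrow> 'a \<Rightarrow> real) \<Rightarrow> bool" where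
  "ma_solution M S p \<phi> D u Y \<longleftrightarrow>
     (let \<Psi> = nabla_inv_lag S D * inv_mat (Phi_lag S p \<phi>) in
      \<forall>\<tau>::int. \<forall>s\<in>{1..S}.
        ms_sums M
          (\<lambda>j \<omega>. \<Sum>k=1..S. fps_nth (\<Psi> $$ (s - 1, k - 1)) j * u (int k + int S * (\<tau> - int j)) \<omega>)
          (Y (int s + int S * \<tau>)))"

definition Omega :: "nat \<Rightarrow> (int \<Rightarrow> real) \<Rightarrow> real mat" where
  "Omega S \<sigma> = mat_diag S (\<lambda>a. (\<sigma> (int a + 1))\<^sup>2)"

end

theory Submission
  imports Defs "HOL-Complex_Analysis.Cauchy_Integral_Formula"
begin

text \<open>
The innovations of season \<open>k\<close> enter season \<open>s\<close> of the moving average through the filter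
\<open>(1 - L) powr (- D\<^sub>s) * \<Pi>\<^sub>s\<^sub>k(L)\<close>, where \<open>\<Pi>(L)\<close> is the inverse of \<open>\<Phi>(L)\<close>.  The two factors
have very different memory.

The factor \<open>\<Pi>\<^sub>s\<^sub>k(L)\<close> is short.  The root condition says that \<open>det \<Phi>(w)\<close> has no zero with
\<open>\<bar>w\<bar> \<le> 1\<close> (\<open>det_Phi_poly_nonzero\<close>), so the entries of \<open>\<Phi>(w)\<inverse>\<close>, adjugate over determinant,
are power series with radius of convergence above 1, and their values at 1 form the matrix
\<open>\<Phi>(1)\<inverse>\<close> (\<open>inverse_Phi_lag\<close>).  The coefficients of \<open>(1 - L) powr (- d)\<close> with \<open>d > 0\<close>, in
contrast, follow the power law \<open>n powr (d - 1) / Gamma d\<close> (\<open>frac_coeff_asymp\<close>).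
Convolution with the short factor preserves this law and multiplies its constant by the sum of the
short coefficients, \<open>\<Pi>\<^sub>s\<^sub>k(1)\<close> (\<open>convolution_asymp\<close>).

Since the innovations are uncorrelated, and the covariance is continuous in mean square, the
covariance of season \<open>s\<close> with season \<open>r\<close> at a distance of \<open>n\<close> blocks is
\<open>\<Sum>\<^sub>k \<sigma>\<^sub>k\<^sup>2 \<Sum>\<^sub>j \<psi>\<^sub>s\<^sub>k(j) \<psi>\<^sub>r\<^sub>k(j + n)\<close>, where \<open>\<psi>\<close> denotes the filter weights
(\<open>moving_average_covariance\<close>).  It remains to find the growth of such a cross-sum, with
\<open>d = D\<^sub>s\<close> and \<open>e = D\<^sub>r\<close>.

If both are positive, then the cross-sum divided by \<open>n powr (d + e - 1)\<close> is close to a Riemann sum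
with mesh \<open>1 / n\<close> of a multiple of \<open>t powr (d - 1) * (1 + t) powr (e - 1)\<close> over \<open>(0, \<infinity>)\<close>,
whose integral is \<open>Beta d (1 - d - e)\<close>
(\<open>cross_sum_long_long\<close>); division by the constants \<open>Gamma d * Gamma e\<close> of the two power laws leaves
the Gamma quotient of the theorem.  If \<open>d = 0 < e\<close>, the unshifted weights are summable, and the
cross-sum inherits the law of the shifted ones (\<open>cross_sum_short_long\<close>).  If \<open>e = 0\<close>, the shifted
weights decay so fast that the limit is 0 (\<open>cross_sum_bounded_short\<close>), which agrees with
the convention \<open>1 / Gamma 0 = 0\<close>.
\<close>

section \<open>Power laws and short convolutions\<close>

text \<open>Up to the factor \<open>n / (n + d)\<close>, the quotient is the reciprocal of the \<open>n\<close>-th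
approximant in Euler's limit for \<open>Gamma d\<close>.\<close>

lemma frac_coeff_asymp:
  assumes "d > 0"
  shows "(\<lambda>n. frac_coeff (- d) n / real n powr (d - 1)) \<longlonglongrightarrow> 1 / Gamma d"
proof -
  have "(\<lambda>n. real n / (real n + d)) \<longlonglongrightarrow> 1"
    by real_asymp
  moreover have "Gamma_series d \<longlonglongrightarrow> Gamma d" 
    by (rule Gamma_series_LIMSEQ)
  ultimately have "(\<lambda>n. real n / (real n + d) / Gamma_series d n) \<longlonglongrightarrow> 1 / Gamma d"
    using Gamma_real_pos[OF assms] by (intro tendsto_divide) auto
  moreover have "\<forall>\<^sub>F n in sequentially. real n / (real n + d) / Gamma_series d n =
      frac_coeff (- d) n / real n powr (d - 1)"
    using eventually_gt_at_top[of 0]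
  proof eventually_elim
    case (elim n)
    have cancel: "m / q / (f * (m * r) / (p * q)) = p / f / r"
      if "m > 0" "q > 0" "f > 0" "r > 0" "p > 0" for m q f r p :: real
      using that by (simp add: field_simps)
    have "d \<notin> \<int>\<^sub>\<le>\<^sub>0" using assms by (auto elim: nonpos_Ints_cases)
    then have p: "pochhammer d n = Gamma (d + real n) / Gamma d"
      by (rule pochhammer_Gamma)
    have pos: "pochhammer d n > 0" using assms by (rule pochhammer_pos)
    have f: "frac_coeff (- d) n = pochhammer d n / fact n"
      using assms by (simp add: frac_coeff_def p add.commute Gamma_fact[symmetric])
    have "exp (d * ln (real n)) = real n * real n powr (d - 1)"
      using elim by (simp add: powr_def exp_diff algebra_simps exp_minus)
    then show ?case
      using elim assms pos cancel[of "real n" "real n + d" "fact n" "real n powr (d - 1)" "pochhammer d n"]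
      by (simp add: f Gamma_series_def pochhammer_Suc add.commute[of d])
  qed
  ultimately show ?thesis by (rule Lim_transform_eventually)
qed

text \<open>The shift to \<open>n + 1\<close> makes the bound meaningful at \<open>n = 0\<close>, where \<open>0 powr a = 0\<close>.  These
global bounds supply the majorants in the dominated convergence arguments below.\<close>

lemma powr_asymp_bound:
  fixes x :: "nat \<Rightarrow> real"
  assumes "(\<lambda>n. x n / real n powr a) \<longlonglongrightarrow> c"
  obtains C where "C \<ge> 0" "\<And>n. \<bar>x n\<bar> \<le> C * real (n + 1) powr a"
proof -
  have "(\<lambda>n. x n / real n powr a * (real n / real (n+1)) powr a) \<longlonglongrightarrow> c * 1 powr a"
    by (intro tendsto_mult assms tendsto_powr tendsto_const) (real_asymp | simp)+
  moreover have "\<forall>\<^sub>F n in sequentially. x n / real n powr a * (real n / real (n+1)) powr a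
       = x n / real (n+1) powr a"
    using eventually_gt_at_top[of 0]
    by eventually_elim (simp add: powr_divide)
  ultimately have "(\<lambda>n. x n / real (n+1) powr a) \<longlonglongrightarrow> c * 1 powr a"
    by (rule Lim_transform_eventually)
  then have "Bseq (\<lambda>n. x n / real (n+1) powr a)"
    by (intro convergent_imp_Bseq convergentI)
  then obtain C where C: "C > 0" "\<And>n. norm (x n / real (n+1) powr a) \<le> C"
    by (auto elim: BseqE)
  have "\<bar>x n\<bar> \<le> C * real (n + 1) powr a" for n
    using C(2)[of n] by (simp add: abs_divide field_simps)
  with C(1) show ?thesis by (intro that[of C]) auto
qed

text \<open>A power law is insensitive to shifts, so every term \<open>b i * a (n - i)\<close> contributes
\<open>c * b i\<close> in the limit.  Tannery's theorem permits the exchange of limit and sum: for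
\<open>i \<le> n\<close> one has \<open>n \<le> (i + 1) * (n - i + 1)\<close>, so the shift costs at most a factor
\<open>(i + 1) powr (- \<alpha>) \<le> i + 1\<close>.  This factor is why \<open>b\<close> has to be summable with the weight
\<open>n + 1\<close>.\<close>

lemma convolution_asymp:
  fixes a b :: "nat \<Rightarrow> real"
  assumes \<alpha>: "-1 \<le> \<alpha>" "\<alpha> \<le> 0"
    and a: "(\<lambda>n. a n / real n powr \<alpha>) \<longlonglongrightarrow> c"
    and b: "summable (\<lambda>n. (real n + 1) * \<bar>b n\<bar>)"
  shows "(\<lambda>n. (\<Sum>i\<le>n. b i * a (n - i)) / real n powr \<alpha>) \<longlonglongrightarrow> c * (\<Sum>i. b i)"
proof -
  obtain C where C: "C \<ge> 0" "\<And>n. \<bar>a n\<bar> \<le> C * real (n + 1) powr \<alpha>"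
    using powr_asymp_bound[OF a] by blast
  define f where "f = (\<lambda>k n. if k \<le> n then b k * a (n - k) / real n powr \<alpha> else 0)"
  have lim: "(\<lambda>n. f k n) \<longlonglongrightarrow> b k * c" for k
  proof -
    have "(\<lambda>n. a (n - k) / real (n - k) powr \<alpha>) \<longlonglongrightarrow> c"
      using filterlim_compose[OF a filterlim_minus_const_nat_at_top[of k]] by simp
    moreover have "(\<lambda>n. (real (n - k) / real n) powr \<alpha>) \<longlonglongrightarrow> 1 powr \<alpha>"
    proof (rule tendsto_powr)
      have "(\<lambda>n. (real n - real k) / real n) \<longlonglongrightarrow> 1" by real_asymp
      then show "(\<lambda>n. real (n - k) / real n) \<longlonglongrightarrow> 1"
        by (rule Lim_transform_eventually)
          (use eventually_ge_at_top[of k] in eventually_elim, simp add: of_nat_diff)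
    qed auto
    ultimately have "(\<lambda>n. b k * (a (n - k) / real (n - k) powr \<alpha> * (real (n - k) / real n) powr \<alpha>))
        \<longlonglongrightarrow> b k * (c * 1 powr \<alpha>)"
      by (intro tendsto_mult tendsto_const)
    moreover have "\<forall>\<^sub>F n in sequentially. 
        b k * (a (n - k) / real (n - k) powr \<alpha> * (real (n - k) / real n) powr \<alpha>) = f k n"
      using eventually_gt_at_top[of k]
      by eventually_elim (simp add: f_def powr_divide)
    ultimately show ?thesis by (simp add: Lim_transform_eventually)
  qed
  have bound: "norm (f k n) \<le> C * ((real k + 1) * \<bar>b k\<bar>)" for k n
  proof (cases "k \<le> n \<and> n > 0")
    case True
    define m where "m = n - k"
    have n: "n = m + k" using True by (simp add: m_def)
    have "real (m + 1) powr \<alpha> / real n powr \<alpha> = (real n / real (m + 1)) powr (-\<alpha>)"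
      using True by (simp add: powr_divide powr_minus field_simps)
    also have "\<dots> \<le> (real k + 1) powr (-\<alpha>)"
    proof (rule powr_mono2)
      show "real n / real (m + 1) \<le> real k + 1"
        by (simp add: n field_simps)
    qed (use \<alpha> in auto)
    also have "\<dots> \<le> (real k + 1) powr 1"
      using \<alpha> by (intro powr_mono) auto
    finally have *: "real (m + 1) powr \<alpha> / real n powr \<alpha> \<le> real k + 1" by simp
    have "norm (f k n) = \<bar>b k\<bar> * (\<bar>a m\<bar> / real n powr \<alpha>)"
      using True by (simp add: f_def m_def abs_mult)
    also have "\<dots> \<le> \<bar>b k\<bar> * (C * real (m + 1) powr \<alpha> / real n powr \<alpha>)"
      by (intro mult_left_mono divide_right_mono C) auto
    also have "\<dots> \<le> \<bar>b k\<bar> * (C * (real k + 1))"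
      using * C(1) by (intro mult_left_mono) (simp_all flip: times_divide_eq_right add: mult_left_mono)
    finally show ?thesis by (simp add: mult_ac)
  next
    case False
    then show ?thesis using C(1) by (auto simp: f_def)
  qed
  have "(\<forall>\<^sub>F n in sequentially. summable (\<lambda>k. norm (f k n))) \<and> summable (\<lambda>n. norm (b n * c)) \<and>
      ((\<lambda>n. suminf (\<lambda>k. f k n)) \<longlonglongrightarrow> suminf (\<lambda>k. b k * c))"
    by (rule tannerys_theorem[where M = "\<lambda>k. C * ((real k + 1) * \<bar>b k\<bar>)"])
      (use lim bound b in \<open>auto intro!: always_eventually summable_mult\<close>)
  then have 1: "(\<lambda>n. suminf (\<lambda>k. f k n)) \<longlonglongrightarrow> suminf (\<lambda>k. b k * c)" by blast
  have 2: "suminf (\<lambda>k. f k n) = (\<Sum>i\<le>n. b i * a (n - i)) / real n powr \<alpha>" for n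
    by (subst suminf_finite[of "{..n}"]) (auto simp: f_def sum_divide_distrib)
  have "summable (\<lambda>n. \<bar>b n\<bar>)"
    by (rule summable_comparison_test[OF _ b]) (auto simp: algebra_simps)
  then have "summable b" by (rule summable_rabs_cancel)
  then have "suminf (\<lambda>k. b k * c) = c * suminf b"
    by (simp add: suminf_mult mult.commute[of _ c])
  with 1 2 show ?thesis by simp
qed

section \<open>Cross-sums of two sequences\<close>

lemma shifted_powr_asymp:
  fixes y :: "nat \<Rightarrow> real"
  assumes "(\<lambda>n. y n / real n powr a) \<longlonglongrightarrow> c"
  shows "(\<lambda>n. y (j + n) / real n powr a) \<longlonglongrightarrow> c"
proof -
  have "(\<lambda>n. y (n + j) / real (n + j) powr a * (real (n + j) / real n) powr a) \<longlonglongrightarrow> c * 1 powr a"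
  proof (intro tendsto_mult tendsto_powr tendsto_const)
    show "(\<lambda>n. y (n + j) / real (n + j) powr a) \<longlonglongrightarrow> c"
      using LIMSEQ_ignore_initial_segment[OF assms] .
    show "(\<lambda>n. real (n + j) / real n) \<longlonglongrightarrow> 1" by real_asymp
  qed auto
  moreover have "\<forall>\<^sub>F n in sequentially. 
      y (n + j) / real (n + j) powr a * (real (n + j) / real n) powr a = y (j + n) / real n powr a"
    using eventually_gt_at_top[of 0]
    by eventually_elim (simp add: powr_divide add.commute)
  ultimately show ?thesis by (simp add: Lim_transform_eventually)
qed

text \<open>If the unshifted sequence is summable, then only the shifts of \<open>y\<close> by bounded amounts matter, and
each of them has the same limit \<open>c\<close> after scaling.\<close>

lemma cross_sum_short_long:
  fixes x y :: "nat \<Rightarrow> real"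
  assumes x: "summable (\<lambda>n. \<bar>x n\<bar>)" and "a \<le> 0"
    and y: "(\<lambda>n. y n / real n powr a) \<longlonglongrightarrow> c"
  shows "(\<lambda>n. (\<Sum>j. x j * y (j + n)) / real n powr a) \<longlonglongrightarrow> c * (\<Sum>j. x j)"
proof -
  obtain C where C: "C \<ge> 0" "\<And>n. \<bar>y n\<bar> \<le> C * real (n + 1) powr a"
    using powr_asymp_bound[OF y] by blast
  define f where "f = (\<lambda>k n. x k * y (k + n) / real n powr a)"
  have lim: "(\<lambda>n. f k n) \<longlonglongrightarrow> x k * c" for k
    using tendsto_mult[OF tendsto_const[of "x k"] shifted_powr_asymp[OF y, of k]]
    by (simp add: f_def)
  have bound: "norm (f k n) \<le> C * \<bar>x k\<bar>" for k n
  proof (cases "n > 0")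
    case True
    have "\<bar>y (k + n)\<bar> \<le> C * real (k + n + 1) powr a" by (rule C)
    also have "\<dots> \<le> C * real n powr a"
      using True \<open>a \<le> 0\<close> C(1) by (intro mult_left_mono powr_mono2') auto
    finally have "\<bar>y (k + n)\<bar> / real n powr a \<le> C"
      using True by (simp add: field_simps)
    from mult_left_mono[OF this, of "\<bar>x k\<bar>"] show ?thesis
      by (simp add: f_def abs_mult mult.commute)
  qed (use C(1) in \<open>simp add: f_def\<close>)
  have "(\<forall>\<^sub>F n in sequentially. summable (\<lambda>k. norm (f k n))) \<and> summable (\<lambda>n. norm (x n * c)) \<and>
      ((\<lambda>n. suminf (\<lambda>k. f k n)) \<longlonglongrightarrow> suminf (\<lambda>k. x k * c))"
    by (rule tannerys_theorem[where M = "\<lambda>k. C * \<bar>x k\<bar>"])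
      (use lim bound x in \<open>auto intro!: always_eventually summable_mult\<close>)
  then have ev: "\<forall>\<^sub>F n in sequentially. summable (\<lambda>k. norm (f k n))"
    and 1: "(\<lambda>n. suminf (\<lambda>k. f k n)) \<longlonglongrightarrow> suminf (\<lambda>k. x k * c)" by blast+
  have "\<forall>\<^sub>F n in sequentially. suminf (\<lambda>k. f k n) = (\<Sum>j. x j * y (j + n)) / real n powr a"
    using ev eventually_gt_at_top[of 0]
  proof eventually_elim
    case (elim n)
    have "summable (\<lambda>k. f k n)" using elim(1) by (rule summable_norm_cancel)
    then have "summable (\<lambda>k. f k n * real n powr a)" by (rule summable_mult2)
    then have "summable (\<lambda>k. x k * y (k + n))" using elim(2) by (simp add: f_def)
    then show ?case by (simp add: f_def suminf_divide)
  qed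
  with 1 have "(\<lambda>n. (\<Sum>j. x j * y (j + n)) / real n powr a) \<longlonglongrightarrow> suminf (\<lambda>k. x k * c)"
    by (rule Lim_transform_eventually)
  moreover have "suminf (\<lambda>k. x k * c) = c * suminf x"
    using summable_rabs_cancel[OF x] by (simp add: suminf_mult mult.commute[of _ c])
  ultimately show ?thesis by simp
qed

text \<open>The scaling factor \<open>n powr (- a)\<close> is at most \<open>n\<close>, hence at most \<open>j + n + 1\<close>, so it can be
absorbed into the weight of \<open>y (j + n)\<close>; what remains is a tail of a convergent series.\<close>

lemma cross_sum_bounded_short:
  fixes x y :: "nat \<Rightarrow> real"
  assumes x: "\<And>n. \<bar>x n\<bar> \<le> C" and a: "a \<ge> -1"
    and y: "summable (\<lambda>n. (real n + 1) * \<bar>y n\<bar>)"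
  shows "(\<lambda>n. (\<Sum>j. x j * y (j + n)) / real n powr a) \<longlonglongrightarrow> 0"
proof -
  define g where "g = (\<lambda>n. (real n + 1) * \<bar>y n\<bar>)"
  have "(\<lambda>n. C * (suminf g - sum g {..<n})) \<longlonglongrightarrow> C * (suminf g - suminf g)"
    using y by (intro tendsto_intros summable_LIMSEQ) (simp add: g_def)
  then have lim: "(\<lambda>n. C * (suminf g - sum g {..<n})) \<longlonglongrightarrow> 0" by simp
  have C: "C \<ge> 0" using x[of 0] by linarith
  have sg: "summable g" using y by (simp add: g_def)
  have "\<forall>\<^sub>F n in sequentially. 
      norm ((\<Sum>j. x j * y (j + n)) / real n powr a) \<le> C * (suminf g - sum g {..<n})"
    using eventually_gt_at_top[of 0]
  proof eventually_elim
    case (elim n)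
    have n: "1 / real n powr a \<le> real n"
    proof -
      have "1 / real n powr a = real n powr (-a)" by (simp add: powr_minus field_simps)
      also have "\<dots> \<le> real n powr 1" using elim a by (intro powr_mono) auto
      finally show ?thesis using elim by simp
    qed
    have le: "norm (x j * y (j + n) / real n powr a) \<le> C * g (j + n)" for j
    proof -
      have "norm (x j * y (j + n) / real n powr a) = \<bar>x j\<bar> * (\<bar>y (j + n)\<bar> * (1 / real n powr a))"
        by (simp add: abs_mult)
      also have "\<dots> \<le> C * (\<bar>y (j + n)\<bar> * (real (j + n) + 1))"
        using n x C by (intro mult_mono) (auto intro: order_trans)
      finally show ?thesis by (simp add: g_def mult_ac)
    qed
    have s: "summable (\<lambda>j. C * g (j + n))" 
      using sg by (intro summable_mult) (simp add: summable_iff_shift)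
    have s2: "summable (\<lambda>j. norm (x j * y (j + n) / real n powr a))"
      by (rule summable_comparison_test[OF _ s]) (use le in auto)
    from summable_norm_cancel[OF s2] have s3: "summable (\<lambda>j. x j * y (j + n) / real n powr a)" .
    from summable_mult2[OF this, of "real n powr a"] elim 
    have s4: "summable (\<lambda>j. x j * y (j + n))" by simp
    have "norm ((\<Sum>j. x j * y (j + n)) / real n powr a) = norm (\<Sum>j. x j * y (j + n) / real n powr a)"
      using s4 by (simp add: suminf_divide)
    also have "\<dots> \<le> (\<Sum>j. norm (x j * y (j + n) / real n powr a))"
      by (rule summable_norm[OF s2])
    also have "\<dots> \<le> (\<Sum>j. C * g (j + n))"
      by (rule suminf_le[OF le s2 s])
    also have "\<dots> = C * (\<Sum>j. g (j + n))"
      using sg by (intro suminf_mult) (simp add: summable_iff_shift)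
    also have "(\<Sum>j. g (j + n)) = suminf g - sum g {..<n}"
      by (rule suminf_minus_initial_segment[OF sg])
    finally show ?case .
  qed
  then show ?thesis by (rule Lim_null_comparison[OF _ lim])
qed

text \<open>The substitution \<open>x = t / (1 + t)\<close> maps \<open>(0, \<infinity>)\<close> onto \<open>(0, 1)\<close> and turns this
integral into Euler's integral for \<open>Beta d (1 - d - e)\<close>.\<close>

lemma Beta_kernel:
  assumes "d > 0" "d + e < (1::real)"
  shows "set_integrable lborel {0<..} (\<lambda>t. t powr (d - 1) * (1 + t) powr (e - 1))"
    and "(LINT t:{0<..}|lborel. t powr (d - 1) * (1 + t) powr (e - 1)) = Beta d (1 - d - e)"
proof -
  define f where "f = (\<lambda>x::real. x powr (d - 1) * (1 - x) powr (1 - d - e - 1))"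
  define k where "k = (\<lambda>t::real. t powr (d - 1) * (1 + t) powr (e - 1))"
  define g where "g = (\<lambda>t::real. t / (1 + t))"
  have img: "g ` {0<..} = {0<..<1}"
  proof (intro equalityI subsetI)
    fix x assume "x \<in> {0<..<(1::real)}"
    then show "x \<in> g ` {0<..}"
      by (intro image_eqI[of _ _ "x / (1 - x)"]) (auto simp: g_def field_simps)
  qed (auto simp: g_def field_simps)
  have inj: "inj_on g {0<..}"
    by (auto simp: inj_on_def g_def field_simps)
  have der: "(g has_field_derivative 1 / (1 + t)\<^sup>2) (at t within {0<..})" if "t \<in> {0<..}" for t
    using that unfolding g_def
    by (auto intro!: derivative_eq_intros simp: power2_eq_square field_simps)
  have fI: "(f has_integral Beta d (1 - d - e)) {0<..<1}"
    using has_integral_Beta_real[of d "1 - d - e"] assms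
    by (simp add: f_def has_integral_Icc_iff_Ioo)
  have fA: "f absolutely_integrable_on {0<..<1}"
    using fI by (intro nonnegative_absolutely_integrable_1) (auto simp: f_def integrable_on_def)
  have *: "(\<lambda>t. \<bar>1 / (1 + t)\<^sup>2\<bar> * f (g t)) absolutely_integrable_on {0<..} \<and>
      integral {0<..} (\<lambda>t. \<bar>1 / (1 + t)\<^sup>2\<bar> * f (g t)) = Beta d (1 - d - e)"
    using has_absolute_integral_change_of_variables_1'[of "{0<..}" g "\<lambda>t. 1 / (1 + t)\<^sup>2" f
        "Beta d (1 - d - e)"] der inj fA fI
    by (simp add: img integral_unique)
  have eq: "\<bar>1 / (1 + t)\<^sup>2\<bar> * f (g t) = k t" if "t \<in> {0<..}" for t
  proof -
    have t: "t > 0" "1 + t > 0" using that by auto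
    have "1 - g t = 1 / (1 + t)" using t by (simp add: g_def field_simps)
    then have b: "(1 - g t) powr (1 - d - e - 1) = (1 + t) powr (d + e)"
      using t powr_minus_divide[of "1 + t" "d + e"] by (simp add: powr_divide)
    have a: "g t powr (d - 1) = t powr (d - 1) * (1 + t) powr (1 - d)"
      using t powr_minus_divide[of "1 + t" "d - 1"] by (simp add: g_def powr_divide)
    have c: "\<bar>1 / (1 + t)\<^sup>2\<bar> = (1 + t) powr (- 2)"
      using t by (simp add: powr_minus_divide)
    have "\<bar>1 / (1 + t)\<^sup>2\<bar> * f (g t) =
        t powr (d - 1) * ((1 + t) powr (- 2) * (1 + t) powr (1 - d) * (1 + t) powr (d + e))"
      unfolding f_def a b c by (simp only: mult_ac)
    also have "(1 + t) powr (- 2) * (1 + t) powr (1 - d) * (1 + t) powr (d + e) = (1 + t) powr (e - 1)"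
      by (simp flip: powr_add)
    finally show ?thesis by (simp add: k_def)
  qed
  have kA: "k absolutely_integrable_on {0<..}"
    by (rule iffD1[OF set_integrable_cong[OF refl refl eq] conjunct1[OF *]])
  have kI: "integral {0<..} k = Beta d (1 - d - e)"
  proof -
    have "integral {0<..} k = integral {0<..} (\<lambda>t. \<bar>1 / (1 + t)\<^sup>2\<bar> * f (g t))"
      by (rule integral_cong) (simp only: eq)
    then show ?thesis using * by simp
  qed
  have meas: "(\<lambda>t. indicator {0<..} t *\<^sub>R k t) \<in> borel_measurable lborel"
    unfolding k_def by measurable
  show 1: "set_integrable lborel {0<..} (\<lambda>t. t powr (d - 1) * (1 + t) powr (e - 1))"
    using kA integrable_completion[OF meas] unfolding set_integrable_def k_def by simp
  have "(LINT t:{0<..}|lborel. k t) = (LINT t:{0<..}|lebesgue. k t)"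
    unfolding set_lebesgue_integral_def using meas by (simp add: integral_completion)
  also have "\<dots> = integral {0<..} k"
    by (rule set_lebesgue_integral_eq_integral(2)[OF kA])
  finally show "(LINT t:{0<..}|lborel. t powr (d - 1) * (1 + t) powr (e - 1)) = Beta d (1 - d - e)"
    using kI by (simp add: k_def)
qed

text \<open>Cells of width \<open>1 / n\<close> that are open on the left: the index \<open>j\<close> of the cell of \<open>t\<close> then satisfies
\<open>j + 1 \<ge> n * t\<close>, which is the direction that bounds a decreasing power of \<open>j + 1\<close> by the same
power of \<open>n * t\<close>.\<close>

lemma cell_partition:
  assumes "n > (0::nat)"
  shows "(\<Union>j::nat. {real j / real n <.. real (j + 1) / real n}) = {0<..}"
    and "\<And>i j. i \<noteq> j \<Longrightarrow> {real i / real n <.. real (i + 1) / real n} \<inter> {real j / real n <.. real (j + 1) / real n} = {}"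
    and "\<And>j t. t \<in> {real j / real n <.. real (j + 1) / real n} \<Longrightarrow> nat (\<lceil>real n * t\<rceil> - 1) = j"
proof -
  show c: "nat (\<lceil>real n * t\<rceil> - 1) = j" if "t \<in> {real j / real n <.. real (j + 1) / real n}" for j t
  proof -
    have "\<lceil>real n * t\<rceil> = int j + 1"
      using that assms by (intro ceiling_unique) (auto simp: field_simps)
    then show ?thesis by simp
  qed
  then show "{real i / real n <.. real (i + 1) / real n} \<inter> {real j / real n <.. real (j + 1) / real n} = {}"
    if "i \<noteq> j" for i j using that c by blast
  show "(\<Union>j::nat. {real j / real n <.. real (j + 1) / real n}) = {0<..}"
  proof (intro equalityI subsetI)
    fix t :: real assume "t \<in> {0<..}"
    then have "real n * t > 0" using assms by simp
    then have "real n * t > real (nat (\<lceil>real n * t\<rceil> - 1))" "real n * t \<le> real (nat (\<lceil>real n * t\<rceil> - 1) + 1)"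
      by linarith+
    then show "t \<in> (\<Union>j::nat. {real j / real n <.. real (j + 1) / real n})"
      using assms by (intro UN_I[of "nat (\<lceil>real n * t\<rceil> - 1)"]) (auto simp: field_simps)
  next
    fix t assume "t \<in> (\<Union>j::nat. {real j / real n <.. real (j + 1) / real n})"
    then obtain j where "real j / real n < t" by auto
    moreover have "real j / real n \<ge> 0" by simp
    ultimately show "t \<in> {0<..}" by (simp del: zero_le_divide_iff divide_nonneg_nonneg)
  qed
qed

lemma cross_sum_summable:
  fixes x y :: "nat \<Rightarrow> real"
  assumes x: "\<And>j. \<bar>x j\<bar> \<le> C * real (j + 1) powr a" and y: "\<And>j. \<bar>y j\<bar> \<le> K * real (j + 1) powr b"
    and "b \<le> 0" "a + b < -1"
  shows "summable (\<lambda>j. x j * y (j + n))"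
proof -
  have K: "K \<ge> 0" using y[of 0] by simp
  have bound: "norm (x j * y (j + n)) \<le> C * K * real (j + 1) powr (a + b)" for j
  proof -
    have "\<bar>y (j + n)\<bar> \<le> K * real (j + 1) powr b"
      using \<open>b \<le> 0\<close> K by (intro order_trans[OF y] mult_left_mono powr_mono2') auto
    then have "\<bar>x j\<bar> * \<bar>y (j + n)\<bar> \<le> (C * real (j + 1) powr a) * (K * real (j + 1) powr b)"
      using x[of j] by (intro mult_mono order_trans[OF abs_ge_zero x]) auto
    also have "\<dots> = C * K * (real (j + 1) powr a * real (j + 1) powr b)"
      by (simp only: mult_ac)
    also have "real (j + 1) powr a * real (j + 1) powr b = real (j + 1) powr (a + b)"
      unfolding powr_add ..
    finally show ?thesis by (simp add: abs_mult)
  qed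
  have "summable (\<lambda>j. real j powr (a + b))"
    using assms(4) by (subst summable_real_powr_iff) simp
  then have "summable (\<lambda>j. real (j + 1) powr (a + b))"
    by (subst summable_iff_shift[of "\<lambda>j. real j powr (a + b)" 1])
  then have "summable (\<lambda>j. C * K * real (j + 1) powr (a + b))" by (rule summable_mult)
  then show ?thesis by (rule summable_comparison_test[rotated]) (use bound in auto)
qed

text \<open>The scaled sum is the integral over \<open>(0, \<infinity>)\<close> of a step function with cells of width
\<open>1 / n\<close>, namely \<open>F n t = n powr (2 - d - e) * x j * y (j + n)\<close> on the \<open>j\<close>-th cell.
Because \<open>j / n\<close> is close to \<open>t\<close> there, \<open>F n\<close> tends pointwise to \<open>A * B\<close> times the kernel
\<open>t powr (d - 1) * (1 + t) powr (e - 1)\<close>, and the bounds on \<open>x\<close> and \<open>y\<close> dominate it by a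
multiple of the same kernel.  The condition \<open>d + e < 1\<close> makes the kernel integrable at
infinity.\<close>

lemma cross_sum_long_long:
  fixes x y :: "nat \<Rightarrow> real"
  assumes d: "0 < d" and e: "0 < e" and de: "d + e < 1"
    and x: "(\<lambda>n. x n / real n powr (d - 1)) \<longlonglongrightarrow> A"
    and y: "(\<lambda>n. y n / real n powr (e - 1)) \<longlonglongrightarrow> B"
  shows "(\<lambda>n. (\<Sum>j. x j * y (j + n)) / real n powr (d + e - 1)) \<longlonglongrightarrow> A * B * Beta d (1 - d - e)"
proof -
  obtain C where C: "C \<ge> 0" "\<And>n. \<bar>x n\<bar> \<le> C * real (n + 1) powr (d - 1)"
    using powr_asymp_bound[OF x] by blast
  obtain K where K: "K \<ge> 0" "\<And>n. \<bar>y n\<bar> \<le> K * real (n + 1) powr (e - 1)"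
    using powr_asymp_bound[OF y] by blast
  \<comment> \<open>index of the cell of width \<open>1 / n\<close> that contains \<open>t\<close>\<close>
  define q where "q = (\<lambda>(n::nat) t. nat (\<lceil>real n * t\<rceil> - 1))"
  define F where "F = (\<lambda>n t. x (q n t) * y (q n t + n) / real n powr (d + e - 2))"
  define k where "k = (\<lambda>t::real. t powr (d - 1) * (1 + t) powr (e - 1))"
  define s where "s = (\<lambda>n t. indicator {0<..} t * F n t)"
  have k: "set_integrable lborel {0<..} k" "(LINT t:{0<..}|lborel. k t) = Beta d (1 - d - e)"
    using Beta_kernel[of d e] d de by (simp_all add: k_def)
  have meas: "s n \<in> borel_measurable lborel" for n
  proof -
    have "q n \<in> measurable lborel (count_space UNIV)"
      unfolding q_def by measurable
    then show ?thesis unfolding s_def F_def by measurable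
  qed
  have bound: "norm (s n t) \<le> C * K * (indicator {0<..} t *\<^sub>R k t)" for n t
  proof (cases "n > 0 \<and> t > 0")
    case True
    then have n: "n > 0" and t: "t > 0" by auto
    have "real n * t > 0" using n t by simp
    then have j: "real (q n t + 1) \<ge> real n * t" unfolding q_def by linarith
    then have jn: "real n * (1 + t) \<le> real (q n t + n + 1)" by (simp add: algebra_simps)
    have "\<bar>x (q n t)\<bar> \<le> C * (real n * t) powr (d - 1)"
      using j d e de n t C(1) by (intro order_trans[OF C(2)] mult_left_mono powr_mono2') auto
    moreover have "\<bar>y (q n t + n)\<bar> \<le> K * (real n * (1 + t)) powr (e - 1)"
      using jn e de d n t K(1)
      by (intro order_trans[OF K(2)] mult_left_mono powr_mono2') auto
    ultimately have "\<bar>x (q n t)\<bar> * \<bar>y (q n t + n)\<bar> \<le>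
        (C * (real n * t) powr (d - 1)) * (K * (real n * (1 + t)) powr (e - 1))"
      using C(1) by (intro mult_mono) auto
    also have "\<dots> = C * K * k t * (real n powr (d - 1) * real n powr (e - 1))"
      using n t by (simp add: powr_mult k_def)
    also have "real n powr (d - 1) * real n powr (e - 1) = real n powr (d + e - 2)"
      by (simp flip: powr_add)
    finally have "\<bar>x (q n t)\<bar> * \<bar>y (q n t + n)\<bar> / real n powr (d + e - 2) \<le> C * K * k t"
      using n by (simp add: field_simps)
    then show ?thesis using t by (simp add: s_def F_def abs_mult)
  next
    case False
    then show ?thesis using C(1) K(1) by (auto simp: s_def F_def k_def)
  qed
  have wint: "integrable lborel (\<lambda>t. C * K * (indicator {0<..} t *\<^sub>R k t))"
    using k(1) unfolding set_integrable_def by (rule integrable_mult_right)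
  have lim: "(\<lambda>n. s n t) \<longlonglongrightarrow> A * B * (indicator {0<..} t *\<^sub>R k t)" for t
  proof (cases "t > 0")
    case True
    have q_div: "(\<lambda>n. real (q n t) / real n) \<longlonglongrightarrow> t"
    proof (rule tendsto_sandwich)
      show "(\<lambda>n. (real n * t - 1) / real n) \<longlonglongrightarrow> t" "(\<lambda>n::nat. t) \<longlonglongrightarrow> t"
        using True by (real_asymp | simp)+
      show "\<forall>\<^sub>F n in sequentially. (real n * t - 1) / real n \<le> real (q n t) / real n"
        by (intro always_eventually allI divide_right_mono) (auto simp: q_def, linarith?)
      show "\<forall>\<^sub>F n in sequentially. real (q n t) / real n \<le> t"
        using eventually_gt_at_top[of 0]
      proof eventually_elim
        case (elim n)
        then have "real n * t > 0" using True by simp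
        then have "real (q n t) \<le> real n * t" unfolding q_def by linarith
        then show ?case using elim by (simp add: field_simps)
      qed
    qed
    have q_top: "filterlim (\<lambda>n. q n t) at_top sequentially"
    proof -
      have "filterlim (\<lambda>n. real n * t - 1) at_top sequentially" using True by real_asymp
      then have "filterlim (\<lambda>n. real (q n t)) at_top sequentially"
        by (rule filterlim_at_top_mono) (auto intro!: always_eventually simp: q_def, linarith?)
      then show ?thesis by (simp add: filterlim_sequentially_iff_filterlim_real)
    qed
    have qn_top: "filterlim (\<lambda>n. q n t + n) at_top sequentially"
      by (rule filterlim_at_top_mono[OF filterlim_ident]) auto
    have "(\<lambda>n. x (q n t) / real (q n t) powr (d - 1) * (real (q n t) / real n) powr (d - 1) *
        (y (q n t + n) / real (q n t + n) powr (e - 1) * (1 + real (q n t) / real n) powr (e - 1)))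
        \<longlonglongrightarrow> A * t powr (d - 1) * (B * (1 + t) powr (e - 1))"
      using True
      by (intro tendsto_mult tendsto_powr tendsto_add tendsto_const q_div
          filterlim_compose[OF x q_top] filterlim_compose[OF y qn_top]) auto
    moreover have "\<forall>\<^sub>F n in sequentially. 
        x (q n t) / real (q n t) powr (d - 1) * (real (q n t) / real n) powr (d - 1) *
        (y (q n t + n) / real (q n t + n) powr (e - 1) * (1 + real (q n t) / real n) powr (e - 1)) = s n t"
      using eventually_gt_at_top[of 0] eventually_compose_filterlim[OF eventually_gt_at_top[of 0] q_top]
    proof eventually_elim
      case (elim n)
      have "1 + real (q n t) / real n = real (q n t + n) / real n" using elim by (simp add: field_simps)
      moreover have "real n powr (d + e - 2) = real n powr (d - 1) * real n powr (e - 1)"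
        by (simp flip: powr_add)
      ultimately show ?case using elim True
        by (simp add: s_def F_def powr_divide del: of_nat_add)
    qed
    ultimately have "(\<lambda>n. s n t) \<longlonglongrightarrow> A * t powr (d - 1) * (B * (1 + t) powr (e - 1))"
      by (rule Lim_transform_eventually)
    then show ?thesis using True by (simp add: k_def mult_ac)
  qed (simp add: s_def)
  have L1: "(\<lambda>n. LINT t|lborel. s n t) \<longlonglongrightarrow> (LINT t|lborel. A * B * (indicator {0<..} t *\<^sub>R k t))"
    by (rule integral_dominated_convergence[OF _ meas wint])
      (use lim bound k in \<open>auto simp: set_integrable_def intro!: borel_measurable_integrable\<close>)
  have L2: "(LINT t|lborel. A * B * (indicator {0<..} t *\<^sub>R k t)) = A * B * Beta d (1 - d - e)"
    using k(2) unfolding set_lebesgue_integral_def by (subst integral_mult_right_zero) simp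
  \<comment> \<open>On the cell with index \<open>j\<close> the function \<open>F n\<close> is constant, so its integral is a series.\<close>
  have L3: "\<forall>\<^sub>F n in sequentially. (LINT t|lborel. s n t) = 
      (\<Sum>j. x j * y (j + n)) / real n powr (d + e - 1)"
    using eventually_gt_at_top[of 0]
  proof eventually_elim
    case (elim n)
    define I where "I = (\<lambda>j::nat. {real j / real n <.. real (j + 1) / real n})"
    note part = cell_partition(1,3)[OF elim, folded I_def q_def]
    have disjoint: "I i \<inter> I j = {}" if "i \<noteq> j" for i j
      using cell_partition(2)[OF elim that] by (simp add: I_def)
    have "integrable lborel (s n)"
      by (rule Bochner_Integration.integrable_bound[OF wint meas]) (use order_trans[OF bound[of n] abs_ge_self] in simp)
    then have si: "set_integrable lborel (\<Union>j. I j) (F n)"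
      unfolding set_integrable_def part(1) s_def by simp
    have "(LINT t|lborel. s n t) = (LINT t:(\<Union>j. I j)|lborel. F n t)"
      unfolding set_lebesgue_integral_def part(1) s_def by simp
    also have "\<dots> = (\<Sum>j. LINT t:I j|lborel. F n t)"
      by (rule lebesgue_integral_countable_add[OF _ disjoint si]) (auto simp: I_def)
    also have "(\<lambda>j. LINT t:I j|lborel. F n t) = (\<lambda>j. x j * y (j + n) / real n powr (d + e - 1))"
    proof
      fix j
      have "(LINT t:I j|lborel. F n t) = (LINT t:I j|lborel. x j * y (j + n) / real n powr (d + e - 2))"
        using part(2) by (intro set_lebesgue_integral_cong) (auto simp: I_def F_def q_def)
      also have "\<dots> = measure lborel (I j) * (x j * y (j + n) / real n powr (d + e - 2))"
        unfolding set_lebesgue_integral_def by (simp add: I_def)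
      also have "measure lborel (I j) = 1 / real n"
        by (simp add: I_def divide_right_mono add_divide_distrib)
      also have "1 / real n * (x j * y (j + n) / real n powr (d + e - 2)) = 
          x j * y (j + n) / (real n powr 1 * real n powr (d + e - 2))"
        using elim by simp
      also have "real n powr 1 * real n powr (d + e - 2) = real n powr (d + e - 1)"
        unfolding powr_add[symmetric] by simp
      finally show "(LINT t:I j|lborel. F n t) = x j * y (j + n) / real n powr (d + e - 1)" .
    qed
    also have "(\<Sum>j. x j * y (j + n) / real n powr (d + e - 1)) = 
        (\<Sum>j. x j * y (j + n)) / real n powr (d + e - 1)"
      by (rule suminf_divide[OF cross_sum_summable[OF C(2) K(2)]]) (insert d e de, linarith, linarith)
    finally show ?case .
  qed
  from Lim_transform_eventually[OF L1 L3] show ?thesis unfolding L2 .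
qed

section \<open>Covariances of mean-square convergent moving averages\<close>

lemma square_integrable_mult:
  assumes "square_integrable M X" "square_integrable M Z"
  shows "integrable M (\<lambda>\<omega>. X \<omega> * Z \<omega>)"
proof (rule Bochner_Integration.integrable_bound)
  show "integrable M (\<lambda>\<omega>. (X \<omega>)\<^sup>2 + (Z \<omega>)\<^sup>2)"
    using assms by (auto simp: square_integrable_def)
  show "(\<lambda>\<omega>. X \<omega> * Z \<omega>) \<in> borel_measurable M"
    using assms by (auto simp: square_integrable_def)
  have "\<bar>a * b\<bar> \<le> a\<^sup>2 + b\<^sup>2" for a b :: real
  proof -
    have "2 * (\<bar>a\<bar> * \<bar>b\<bar>) \<le> a\<^sup>2 + b\<^sup>2" using sum_squares_bound[of "\<bar>a\<bar>" "\<bar>b\<bar>"] by simp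
    moreover have "0 \<le> \<bar>a\<bar> * \<bar>b\<bar>" by simp
    ultimately show ?thesis unfolding abs_mult by linarith
  qed
  then show "AE \<omega> in M. norm (X \<omega> * Z \<omega>) \<le> norm ((X \<omega>)\<^sup>2 + (Z \<omega>)\<^sup>2)"
    by auto
qed

lemma square_integrable_add:
  assumes "square_integrable M X" "square_integrable M Z"
  shows "square_integrable M (\<lambda>\<omega>. X \<omega> + Z \<omega>)"
  using assms square_integrable_mult[OF assms]
  by (auto simp: square_integrable_def power2_sum mult.assoc)

lemma square_integrable_cmult:
  assumes "square_integrable M X"
  shows "square_integrable M (\<lambda>\<omega>. c * X \<omega>)"
  using assms by (auto simp: square_integrable_def power_mult_distrib)

lemma square_integrable_diff:
  assumes "square_integrable M X" "square_integrable M Z"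
  shows "square_integrable M (\<lambda>\<omega>. X \<omega> - Z \<omega>)"
  using square_integrable_add[OF assms(1) square_integrable_cmult[OF assms(2), of "-1"]] by simp

lemma square_integrable_sum:
  assumes "\<And>i. i \<in> I \<Longrightarrow> square_integrable M (X i)"
  shows "square_integrable M (\<lambda>\<omega>. \<Sum>i\<in>I. X i \<omega>)"
  using assms
proof (induction I rule: infinite_finite_induct)
  case (insert i I)
  then show ?case by (simp add: square_integrable_add)
qed (auto simp: square_integrable_def)

text \<open>The quadratic polynomial \<open>t \<mapsto> E (X - t Z)\<^sup>2\<close> is nonnegative; evaluate it at its minimum
\<open>C / B\<close>, or far out on the line if \<open>B = 0\<close>.\<close>

lemma Cauchy_Schwarz_expectation:
  assumes X: "square_integrable M X" and Z: "square_integrable M Z"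
  shows "(LINT \<omega>|M. X \<omega> * Z \<omega>)\<^sup>2 \<le> (LINT \<omega>|M. (X \<omega>)\<^sup>2) * (LINT \<omega>|M. (Z \<omega>)\<^sup>2)"
proof -
  define A where "A = (LINT \<omega>|M. (X \<omega>)\<^sup>2)"
  define B where "B = (LINT \<omega>|M. (Z \<omega>)\<^sup>2)"
  define C where "C = (LINT \<omega>|M. X \<omega> * Z \<omega>)"
  have int: "integrable M (\<lambda>\<omega>. (X \<omega>)\<^sup>2)" "integrable M (\<lambda>\<omega>. (Z \<omega>)\<^sup>2)" "integrable M (\<lambda>\<omega>. X \<omega> * Z \<omega>)"
    using X Z square_integrable_mult[OF X Z] by (auto simp: square_integrable_def)
  have q: "0 \<le> A - 2 * t * C + t\<^sup>2 * B" for t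
  proof -
    have "0 \<le> (LINT \<omega>|M. (X \<omega> - t * Z \<omega>)\<^sup>2)" by simp
    also have "(\<lambda>\<omega>. (X \<omega> - t * Z \<omega>)\<^sup>2) = (\<lambda>\<omega>. (X \<omega>)\<^sup>2 - 2 * t * (X \<omega> * Z \<omega>) + t\<^sup>2 * (Z \<omega>)\<^sup>2)"
      by (auto simp: power2_eq_square algebra_simps)
    also have "(LINT \<omega>|M. (X \<omega>)\<^sup>2 - 2 * t * (X \<omega> * Z \<omega>) + t\<^sup>2 * (Z \<omega>)\<^sup>2) = A - 2 * t * C + t\<^sup>2 * B"
      using int by (simp add: A_def B_def C_def)
    finally show ?thesis .
  qed
  have "B \<ge> 0" by (simp add: B_def)
  show ?thesis
  proof (cases "B = 0")
    case True
    have "C = 0"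
    proof (rule ccontr)
      assume "C \<noteq> 0"
      then have "0 \<le> A - (A + 1)" using q[of "(A + 1) / (2 * C)"] True by simp
      then show False by simp
    qed
    then show ?thesis by (simp add: C_def[symmetric] A_def[symmetric] B_def[symmetric] True)
  next
    case False
    then have "B > 0" using \<open>B \<ge> 0\<close> by simp
    then have "0 \<le> A - C\<^sup>2 / B"
      using q[of "C / B"] by (simp add: power2_eq_square field_simps)
    then have "C\<^sup>2 \<le> A * B" using \<open>B > 0\<close> by (simp add: field_simps)
    then show ?thesis by (simp add: A_def B_def C_def)
  qed
qed

lemma tendsto_expectation_mult_null:
  assumes "\<And>n. square_integrable M (X n)" "\<And>n. square_integrable M (Z n)"
    and X: "(\<lambda>n. LINT \<omega>|M. (X n \<omega>)\<^sup>2) \<longlonglongrightarrow> 0" and Z: "(\<lambda>n. LINT \<omega>|M. (Z n \<omega>)\<^sup>2) \<longlonglongrightarrow> c"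
  shows "(\<lambda>n. LINT \<omega>|M. X n \<omega> * Z n \<omega>) \<longlonglongrightarrow> 0"
proof -
  have "(\<lambda>n. (LINT \<omega>|M. (X n \<omega>)\<^sup>2) * (LINT \<omega>|M. (Z n \<omega>)\<^sup>2)) \<longlonglongrightarrow> 0 * c"
    by (intro tendsto_mult X Z)
  then have "(\<lambda>n. (LINT \<omega>|M. (X n \<omega>)\<^sup>2) * (LINT \<omega>|M. (Z n \<omega>)\<^sup>2)) \<longlonglongrightarrow> 0" by simp
  then have "(\<lambda>n. (LINT \<omega>|M. X n \<omega> * Z n \<omega>)\<^sup>2) \<longlonglongrightarrow> 0"
    by (rule Lim_null_comparison[rotated])
      (use Cauchy_Schwarz_expectation[OF assms(1,2)] in auto)
  then show ?thesis by simp
qed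

text \<open>Continuity of the inner product of \<open>L\<^sup>2\<close>: expand \<open>X n * Z n\<close> around \<open>X' * Z'\<close>; each of the
three error terms has a factor that vanishes in mean square.\<close>

lemma tendsto_expectation_mult:
  assumes sX: "\<And>n. square_integrable M (X n)" and sZ: "\<And>n. square_integrable M (Z n)"
    and sX': "square_integrable M X'" and sZ': "square_integrable M Z'"
    and X: "(\<lambda>n. LINT \<omega>|M. (X n \<omega> - X' \<omega>)\<^sup>2) \<longlonglongrightarrow> 0"
    and Z: "(\<lambda>n. LINT \<omega>|M. (Z n \<omega> - Z' \<omega>)\<^sup>2) \<longlonglongrightarrow> 0"
  shows "(\<lambda>n. LINT \<omega>|M. X n \<omega> * Z n \<omega>) \<longlonglongrightarrow> (LINT \<omega>|M. X' \<omega> * Z' \<omega>)"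
proof -
  note dX = square_integrable_diff[OF sX sX'] and dZ = square_integrable_diff[OF sZ sZ']
  have "(\<lambda>n. (LINT \<omega>|M. (X n \<omega> - X' \<omega>) * (Z n \<omega> - Z' \<omega>)) + (LINT \<omega>|M. (X n \<omega> - X' \<omega>) * Z' \<omega>)
       + (LINT \<omega>|M. (Z n \<omega> - Z' \<omega>) * X' \<omega>) + (LINT \<omega>|M. X' \<omega> * Z' \<omega>)) 
      \<longlonglongrightarrow> 0 + 0 + 0 + (LINT \<omega>|M. X' \<omega> * Z' \<omega>)"
    by (intro tendsto_add tendsto_const tendsto_expectation_mult_null[OF dX dZ X Z]
        tendsto_expectation_mult_null[OF dX sZ' X tendsto_const]
        tendsto_expectation_mult_null[OF dZ sX' Z tendsto_const])
  moreover have "(LINT \<omega>|M. (X n \<omega> - X' \<omega>) * (Z n \<omega> - Z' \<omega>)) + (LINT \<omega>|M. (X n \<omega> - X' \<omega>) * Z' \<omega>)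
       + (LINT \<omega>|M. (Z n \<omega> - Z' \<omega>) * X' \<omega>) + (LINT \<omega>|M. X' \<omega> * Z' \<omega>) = (LINT \<omega>|M. X n \<omega> * Z n \<omega>)" for n
  proof -
    note i = square_integrable_mult[OF dX[of n] dZ[of n]] square_integrable_mult[OF dX[of n] sZ']
      square_integrable_mult[OF dZ[of n] sX'] square_integrable_mult[OF sX' sZ']
    have "(LINT \<omega>|M. X n \<omega> * Z n \<omega>) = (LINT \<omega>|M. (X n \<omega> - X' \<omega>) * (Z n \<omega> - Z' \<omega>) + (X n \<omega> - X' \<omega>) * Z' \<omega>
       + (Z n \<omega> - Z' \<omega>) * X' \<omega> + X' \<omega> * Z' \<omega>)"
      by (rule Bochner_Integration.integral_cong) (auto simp: algebra_simps)
    then show ?thesis using i by simp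
  qed
  ultimately show ?thesis by simp
qed

lemma ms_sums_partial:
  assumes "ms_sums M f Z"
  shows "square_integrable M (\<lambda>\<omega>. \<Sum>j<n. f j \<omega>)" "square_integrable M Z"
    "(\<lambda>n. LINT \<omega>|M. ((\<Sum>j<n. f j \<omega>) - Z \<omega>)\<^sup>2) \<longlonglongrightarrow> 0"
  using assms by (auto simp: ms_sums_def intro!: square_integrable_sum)

lemma ms_sums_mean_zero:
  assumes "prob_space M" "ms_sums M f Z" and f: "\<And>j. (LINT \<omega>|M. f j \<omega>) = 0"
  shows "(LINT \<omega>|M. Z \<omega>) = 0"
proof -
  interpret prob_space M by fact
  have one: "square_integrable M (\<lambda>_. 1)" by (simp add: square_integrable_def)
  have int: "integrable M (f j)" for j
    using square_integrable_mult[OF _ one, of "f j"] assms(2) by (simp add: ms_sums_def)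
  have "(\<lambda>n. LINT \<omega>|M. (\<Sum>j<n. f j \<omega>) * 1) \<longlonglongrightarrow> (LINT \<omega>|M. Z \<omega> * 1)"
    by (rule tendsto_expectation_mult) (use ms_sums_partial[OF assms(2)] one in auto)
  then show ?thesis using int f by (simp add: LIMSEQ_const_iff)
qed

text \<open>The partial sums of \<open>X\<close> up to \<open>N\<close> are paired with those of \<open>Z\<close> up to \<open>N + n\<close>, so
that every index \<open>i < N\<close> meets its only correlated partner \<open>i + n\<close>.\<close>

lemma ms_sums_covariance:
  assumes "prob_space M" "ms_sums M f X" "ms_sums M g Z"
    and f: "\<And>j. (LINT \<omega>|M. f j \<omega>) = 0" and g: "\<And>j. (LINT \<omega>|M. g j \<omega>) = 0"
    and orth: "\<And>i j. j \<noteq> i + n \<Longrightarrow> (LINT \<omega>|M. f i \<omega> * g j \<omega>) = 0"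
  shows "(\<lambda>j. LINT \<omega>|M. f j \<omega> * g (j + n) \<omega>) sums covariance M X Z"
proof -
  have cov: "covariance M X Z = (LINT \<omega>|M. X \<omega> * Z \<omega>)"
    using ms_sums_mean_zero[OF assms(1,2) f] ms_sums_mean_zero[OF assms(1,3) g]
    by (simp add: covariance_def)
  note F = ms_sums_partial[OF assms(2)] and G = ms_sums_partial[OF assms(3)]
  have sf: "square_integrable M (f i)" and sg: "square_integrable M (g i)" for i
    using assms(2,3) by (auto simp: ms_sums_def)
  have "(\<lambda>N. LINT \<omega>|M. (\<Sum>i<N. f i \<omega>) * (\<Sum>j<N + n. g j \<omega>)) \<longlonglongrightarrow> (LINT \<omega>|M. X \<omega> * Z \<omega>)"
    by (rule tendsto_expectation_mult) (use F G LIMSEQ_ignore_initial_segment[OF G(3), of n] in auto)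
  moreover have "(LINT \<omega>|M. (\<Sum>i<N. f i \<omega>) * (\<Sum>j<N + n. g j \<omega>)) =
     (\<Sum>i<N. LINT \<omega>|M. f i \<omega> * g (i + n) \<omega>)" for N
  proof -
    have "(LINT \<omega>|M. (\<Sum>i<N. f i \<omega>) * (\<Sum>j<N + n. g j \<omega>)) =
        (\<Sum>i<N. \<Sum>j<N + n. LINT \<omega>|M. f i \<omega> * g j \<omega>)"
      using square_integrable_mult[OF sf sg] by (simp add: sum_product)
    also have "\<dots> = (\<Sum>i<N. LINT \<omega>|M. f i \<omega> * g (i + n) \<omega>)"
    proof (rule sum.cong[OF refl])
      fix i assume "i \<in> {..<N}"
      then have "(\<Sum>j<N + n. LINT \<omega>|M. f i \<omega> * g j \<omega>) = (\<Sum>j\<in>{i + n}. LINT \<omega>|M. f i \<omega> * g j \<omega>)"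
        using orth by (intro sum.mono_neutral_right) auto
      then show "(\<Sum>j<N + n. LINT \<omega>|M. f i \<omega> * g j \<omega>) = (LINT \<omega>|M. f i \<omega> * g (i + n) \<omega>)" by simp
    qed
    finally show ?thesis .
  qed
  ultimately show ?thesis by (simp add: sums_def cov)
qed

lemma white_noise_products:
  assumes "white_noise M \<sigma> u"
  shows "(LINT \<omega>|M. u t \<omega> * u t' \<omega>) = (if t = t' then (\<sigma> t)\<^sup>2 else 0)"
  using assms by (auto simp: white_noise_def covariance_def power2_eq_square)

lemma block_index_eq_iff:
  fixes S k l :: nat and a b :: int
  assumes "k \<in> {1..S}" "l \<in> {1..S}"
  shows "int k + int S * a = int l + int S * b \<longleftrightarrow> k = l \<and> a = b"
proof
  assume eq: "int k + int S * a = int l + int S * b"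
  have "int k - 1 = (int k - 1 + int S * a) mod int S" using assms by simp
  also have "int k - 1 + int S * a = int l - 1 + int S * b" using eq by simp
  also have "\<dots> mod int S = int l - 1" using assms by simp
  finally show "k = l \<and> a = b" using eq assms by auto
qed auto

text \<open>Innovations of different blocks or seasons are uncorrelated, and a block index \<open>\<tau> - i\<close> of the
first series agrees with a block index \<open>\<tau> + n - j\<close> of the second only for \<open>j = i + n\<close>.\<close>

lemma moving_average_covariance:
  fixes \<psi> \<eta> :: "nat \<Rightarrow> nat \<Rightarrow> real" and S n :: nat
  assumes "prob_space M" "white_noise M \<sigma> u"
    and X: "ms_sums M (\<lambda>j \<omega>. \<Sum>k=1..S. \<psi> k j * u (int k + int S * (\<tau> - int j)) \<omega>) X"
    and Z: "ms_sums M (\<lambda>j \<omega>. \<Sum>k=1..S. \<eta> k j * u (int k + int S * (\<tau> + int n - int j)) \<omega>) Z"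
    and per: "periodic S (\<lambda>t. (\<sigma> t)\<^sup>2)"
  shows "(\<lambda>j. \<Sum>k=1..S. (\<sigma> (int k))\<^sup>2 * (\<psi> k j * \<eta> k (j + n))) sums covariance M X Z"
proof -
  interpret prob_space M by fact
  have su: "square_integrable M (u t)" and mu: "(LINT \<omega>|M. u t \<omega>) = 0" for t
    using assms(2) by (auto simp: white_noise_def)
  have iu: "integrable M (u t)" for t
    using square_integrable_mult[OF su[of t], of "\<lambda>_. 1"] by (simp add: square_integrable_def)
  have per': "(\<sigma> (int k + int S * a))\<^sup>2 = (\<sigma> (int k))\<^sup>2" for k a
  proof (induction a rule: int_induct[where k = 0])
    case (step1 i)
    then show ?case using per[unfolded periodic_def, rule_format, of "int k + int S * i"]
      by (simp add: algebra_simps)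
  next
    case (step2 i)
    then show ?case using per[unfolded periodic_def, rule_format, of "int k + int S * (i - 1)"]
      by (simp add: algebra_simps)
  qed simp
  have prod: "(LINT \<omega>|M. (\<Sum>k=1..S. \<psi> k i * u (int k + int S * (\<tau> - int i)) \<omega>) *
      (\<Sum>k=1..S. \<eta> k j * u (int k + int S * (\<tau> + int n - int j)) \<omega>)) = 
      (if j = i + n then \<Sum>k=1..S. (\<sigma> (int k))\<^sup>2 * (\<psi> k i * \<eta> k j) else 0)" for i j
  proof -
    have "(LINT \<omega>|M. (\<Sum>k=1..S. \<psi> k i * u (int k + int S * (\<tau> - int i)) \<omega>) *
      (\<Sum>k=1..S. \<eta> k j * u (int k + int S * (\<tau> + int n - int j)) \<omega>)) = 
      (\<Sum>k=1..S. \<Sum>l=1..S. \<psi> k i * \<eta> l j * 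
         (LINT \<omega>|M. u (int k + int S * (\<tau> - int i)) \<omega> * u (int l + int S * (\<tau> + int n - int j)) \<omega>))"
    proof -
      have i: "integrable M (\<lambda>\<omega>. \<psi> k i * \<eta> l j * 
        (u (int k + int S * (\<tau> - int i)) \<omega> * u (int l + int S * (\<tau> + int n - int j)) \<omega>))" for k l
        by (intro integrable_mult_right square_integrable_mult su)
      have "(\<lambda>\<omega>. (\<Sum>k=1..S. \<psi> k i * u (int k + int S * (\<tau> - int i)) \<omega>) *
        (\<Sum>k=1..S. \<eta> k j * u (int k + int S * (\<tau> + int n - int j)) \<omega>)) =
        (\<lambda>\<omega>. \<Sum>k=1..S. \<Sum>l=1..S. \<psi> k i * \<eta> l j * 
        (u (int k + int S * (\<tau> - int i)) \<omega> * u (int l + int S * (\<tau> + int n - int j)) \<omega>))"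
        by (intro ext) (simp only: sum_product mult_ac)
      then show ?thesis using i by simp
    qed
    also have "\<dots> = (\<Sum>k=1..S. \<Sum>l=1..S. if k = l then 
        (if j = i + n then (\<sigma> (int k))\<^sup>2 * (\<psi> k i * \<eta> k j) else 0) else 0)"
    proof (intro sum.cong refl)
      fix k l assume kl: "k \<in> {1..S}" "l \<in> {1..S}"
      have "\<tau> - int i = \<tau> + int n - int j \<longleftrightarrow> j = i + n" by auto
      then show "\<psi> k i * \<eta> l j * 
         (LINT \<omega>|M. u (int k + int S * (\<tau> - int i)) \<omega> * u (int l + int S * (\<tau> + int n - int j)) \<omega>) =
         (if k = l then (if j = i + n then (\<sigma> (int k))\<^sup>2 * (\<psi> k i * \<eta> k j) else 0) else 0)"
        unfolding white_noise_products[OF assms(2)] block_index_eq_iff[OF kl] per' by simp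
    qed
    also have "\<dots> = (if j = i + n then \<Sum>k=1..S. (\<sigma> (int k))\<^sup>2 * (\<psi> k i * \<eta> k j) else 0)"
      by (simp add: sum.delta)
    finally show ?thesis .
  qed
  have mX: "(LINT \<omega>|M. (\<Sum>k=1..S. \<psi> k j * u (int k + int S * (\<tau> - int j)) \<omega>)) = 0" for j
    using iu mu by simp
  have mZ: "(LINT \<omega>|M. (\<Sum>k=1..S. \<eta> k j * u (int k + int S * (\<tau> + int n - int j)) \<omega>)) = 0" for j
    using iu mu by simp
  have "(\<lambda>j. LINT \<omega>|M. (\<Sum>k=1..S. \<psi> k j * u (int k + int S * (\<tau> - int j)) \<omega>) *
      (\<Sum>k=1..S. \<eta> k (j + n) * u (int k + int S * (\<tau> + int n - int (j + n))) \<omega>)) sums covariance M X Z"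
    by (rule ms_sums_covariance[OF assms(1) X Z mX mZ]) (simp only: prod if_False)
  then show ?thesis unfolding prod by simp
qed

section \<open>The inverse of the autoregressive lag matrix\<close>

lemma inv_mat_eqI:
  assumes "A \<in> carrier_mat n n" "B \<in> carrier_mat n n" "A * B = 1\<^sub>m n" "B * A = 1\<^sub>m n"
  shows "inv_mat A = B"
  unfolding inv_mat_def
proof (rule the_equality)
  show "B \<in> carrier_mat (dim_row A) (dim_row A) \<and> inverts_mat A B \<and> inverts_mat B A"
    using assms by (auto simp: inverts_mat_def)
next
  fix C assume "C \<in> carrier_mat (dim_row A) (dim_row A) \<and> inverts_mat A C \<and> inverts_mat C A"
  then have C: "C \<in> carrier_mat n n" "C * A = 1\<^sub>m n"
    using assms(1) by (auto simp: inverts_mat_def)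
  have "C = C * (A * B)" unfolding assms(3) using C by simp
  also have "\<dots> = (C * A) * B"
    using C assms by (intro assoc_mult_mat[symmetric]) auto
  also have "\<dots> = B" unfolding C(2) using assms by simp
  finally show "C = B" .
qed

text \<open>Cramer's rule.  It holds over any commutative ring, and it is applied to matrices of real numbers
and to matrices of power series.\<close>

lemma inv_mat_if_det_unit:
  fixes A :: "'b::comm_ring_1 mat"
  assumes A: "A \<in> carrier_mat n n" and "c * Determinant.det A = 1"
  shows "inv_mat A = c \<cdot>\<^sub>m adj_mat A" "inv_mat A \<in> carrier_mat n n"
    "A * inv_mat A = 1\<^sub>m n" "inv_mat A * A = 1\<^sub>m n"
proof -
  note adj = adj_mat[OF A]
  have one: "c \<cdot>\<^sub>m (Determinant.det A \<cdot>\<^sub>m 1\<^sub>m n) = 1\<^sub>m n"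
    using assms(2) by (intro eq_matI) (auto simp: mult.assoc[symmetric])
  have l: "A * (c \<cdot>\<^sub>m adj_mat A) = 1\<^sub>m n"
    using mult_smult_distrib[OF A adj(1), of c] adj(2) one by simp
  have r: "(c \<cdot>\<^sub>m adj_mat A) * A = 1\<^sub>m n"
    using mult_smult_assoc_mat[OF adj(1) A, of c] adj(3) one by simp
  show eq: "inv_mat A = c \<cdot>\<^sub>m adj_mat A"
    by (rule inv_mat_eqI[OF A _ l r]) (use adj in auto)
  show "inv_mat A \<in> carrier_mat n n" "A * inv_mat A = 1\<^sub>m n" "inv_mat A * A = 1\<^sub>m n"
    unfolding eq using l r adj by auto
qed

lemma comm_ring_hom_poly_eval: "comm_ring_hom (\<lambda>p::real poly. poly (map_poly complex_of_real p) w)"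
proof -
  have add: "map_poly complex_of_real (p + q) = map_poly of_real p + map_poly of_real q" for p q
    by (rule poly_eqI) (simp add: coeff_map_poly)
  have mult: "map_poly complex_of_real (p * q) = map_poly of_real p * map_poly of_real q" for p q
    by (rule poly_eqI) (simp add: coeff_map_poly coeff_mult)
  show ?thesis
    by unfold_locales (simp_all add: add mult)
qed

lemma comm_ring_hom_fps_of_poly: "comm_ring_hom (fps_of_poly :: real poly \<Rightarrow> real fps)"
  by unfold_locales (simp_all add: fps_of_poly_add fps_of_poly_mult)

text \<open>A polynomial has finitely many roots, so if none lies in the closed unit disc, then its reciprocal
is analytic on a strictly larger disc.  The analytic theorem on reciprocals concerns complex series,
whereas the filters have real coefficients; the embedding of the reals preserves the
norms of the coefficients and hence the radius of convergence.\<close>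

lemma fps_conv_radius_inverse_poly_gt_1:
  fixes q :: "real poly"
  assumes nz: "\<And>w. cmod w \<le> 1 \<Longrightarrow> poly (map_poly complex_of_real q) w \<noteq> 0"
  shows "fps_conv_radius (inverse (fps_of_poly q)) > 1"
proof -
  define qc where "qc = map_poly complex_of_real q"
  define g where "g = inverse (fps_of_poly q)"
  define gc where "gc = Abs_fps (\<lambda>n. complex_of_real (fps_nth g n))"
  have "coeff q 0 \<noteq> 0"
    using nz[of 0] by (simp add: poly_0_coeff_0 coeff_map_poly)
  then have "fps_of_poly q * g = 1"
    unfolding g_def by (intro inverse_mult_eq_1') simp
  have "fps_of_poly qc * gc = 1"
  proof (rule fps_ext)
    fix n
    have "fps_nth (fps_of_poly qc * gc) n = complex_of_real (fps_nth (fps_of_poly q * g) n)"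
      by (simp add: fps_mult_nth qc_def gc_def coeff_map_poly)
    also have "\<dots> = fps_nth 1 n"
      unfolding \<open>fps_of_poly q * g = 1\<close> by simp
    finally show "fps_nth (fps_of_poly qc * gc) n = fps_nth 1 n" .
  qed
  then have gc: "inverse (fps_of_poly qc) = gc" by (rule fps_inverse_unique)
  define Z where "Z = {w. poly qc w = 0}"
  have "qc \<noteq> 0" using nz[of 0] by (auto simp: qc_def)
  then have fin: "finite Z" unfolding Z_def by (rule poly_roots_finite)
  define R where "R = Min (insert 2 (cmod ` Z))"
  have R: "R > 1"
    using fin nz unfolding R_def by (subst Min_gr_iff) (auto simp: Z_def qc_def not_le[symmetric])
  have "eval_fps (fps_of_poly qc) w \<noteq> 0" if "ereal (cmod w) < ereal R" for w
  proof
    assume "eval_fps (fps_of_poly qc) w = 0"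
    then have "R \<le> cmod w" unfolding R_def using fin by (intro Min_le) (auto simp: Z_def)
    with that show False by simp
  qed
  from fps_conv_radius_inverse[where r = "ereal R", OF this] have "fps_conv_radius gc \<ge> ereal R" by (simp add: gc)
  moreover have "fps_conv_radius gc = fps_conv_radius g"
    using fps_conv_radius_norm[of gc] fps_conv_radius_norm[of g] by (simp add: gc_def)
  moreover have "1 < ereal R" using R by (simp add: one_ereal_def)
  ultimately show ?thesis unfolding g_def by (metis less_le_trans)
qed

lemma eval_fps_sum_at_1:
  fixes f :: "'i \<Rightarrow> real fps"
  assumes "finite I" "\<And>i. i \<in> I \<Longrightarrow> fps_conv_radius (f i) > 1"
  shows "eval_fps (\<Sum>i\<in>I. f i) 1 = (\<Sum>i\<in>I. eval_fps (f i) 1) \<and> fps_conv_radius (\<Sum>i\<in>I. f i) > 1"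
  using assms
proof (induction I rule: finite_induct)
  case (insert i I)
  have "fps_conv_radius (f i + sum f I) > 1"
    using insert by (intro less_le_trans[OF _ fps_conv_radius_add]) auto
  then show ?case using insert by (simp add: eval_fps_add one_ereal_def)
qed auto

text \<open>Evaluation at 1 is multiplicative only on series that converge there, so it is not a ring
homomorphism on all power series, and the product of matrices has to be treated entrywise.\<close>

lemma eval_fps_mat_mult_at_1:
  fixes A B :: "real fps mat"
  assumes A: "A \<in> carrier_mat n n" and B: "B \<in> carrier_mat n n"
    and rA: "\<And>i j. i < n \<Longrightarrow> j < n \<Longrightarrow> fps_conv_radius (A $$ (i, j)) > 1"
    and rB: "\<And>i j. i < n \<Longrightarrow> j < n \<Longrightarrow> fps_conv_radius (B $$ (i, j)) > 1"
  shows "map_mat (\<lambda>f. eval_fps f 1) (A * B) = map_mat (\<lambda>f. eval_fps f 1) A * map_mat (\<lambda>f. eval_fps f 1) B"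
proof (rule eq_matI)
  fix i j assume "i < dim_row (map_mat (\<lambda>f. eval_fps f 1) A * map_mat (\<lambda>f. eval_fps f 1) B)"
    "j < dim_col (map_mat (\<lambda>f. eval_fps f 1) A * map_mat (\<lambda>f. eval_fps f 1) B)"
  then have ij: "i < n" "j < n" using A B by auto
  have "eval_fps (\<Sum>k = 0..<n. A $$ (i, k) * B $$ (k, j)) 1 = 
      (\<Sum>k = 0..<n. eval_fps (A $$ (i, k) * B $$ (k, j)) 1)"
  proof (intro conjunct1[OF eval_fps_sum_at_1])
    fix k assume "k \<in> {0..<n}"
    then show "fps_conv_radius (A $$ (i, k) * B $$ (k, j)) > 1"
      using rA rB ij by (intro less_le_trans[OF _ fps_conv_radius_mult]) auto
  qed simp
  also have "\<dots> = (\<Sum>k = 0..<n. eval_fps (A $$ (i, k)) 1 * eval_fps (B $$ (k, j)) 1)"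
    using rA rB ij by (intro sum.cong refl eval_fps_mult) (auto simp: one_ereal_def)
  finally show "map_mat (\<lambda>f. eval_fps f 1) (A * B) $$ (i, j) = 
      (map_mat (\<lambda>f. eval_fps f 1) A * map_mat (\<lambda>f. eval_fps f 1) B) $$ (i, j)"
    using ij A B by (simp add: scalar_prod_def)
qed (use A B in auto)

text \<open>The entries of the lag matrix are polynomials in the lag operator.  Over polynomials the
determinant commutes both with evaluation at complex points, where the root condition
lives, and with the embedding into power series, where the lag filters are inverted.\<close>

definition Phi_poly :: "nat \<Rightarrow> nat \<Rightarrow> (int \<Rightarrow> nat \<Rightarrow> real) \<Rightarrow> real poly mat" where
  "Phi_poly S p \<phi> = Matrix.mat S S (\<lambda>(a, b).
     [:Phi0 S \<phi> $$ (a, b):] - (\<Sum>i=1..ar_order S p. monom (Phi S \<phi> i $$ (a, b)) i))"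

lemma Phi_poly_carrier: "Phi_poly S p \<phi> \<in> carrier_mat S S"
  by (simp add: Phi_poly_def)

lemma Phi_lag_eq: "Phi_lag S p \<phi> = map_mat fps_of_poly (Phi_poly S p \<phi>)"
  by (intro eq_matI) (auto simp: Phi_lag_def Phi_poly_def fps_of_poly_diff fps_of_poly_const
      fps_of_poly_sum fps_of_poly_monom)

lemma Phi_at_one_eq: "Phi_at_one S p \<phi> = map_mat (\<lambda>f. eval_fps f 1) (Phi_lag S p \<phi>)"
  unfolding Phi_lag_eq
  by (intro eq_matI) (auto simp: Phi_at_one_def Phi_poly_def poly_sum poly_monom)

lemma det_Phi0: "Determinant.det (Phi0 S \<phi>) = 1"
proof -
  have "Determinant.det (Phi0 S \<phi>) = prod_list (diag_mat (Phi0 S \<phi>))"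
    by (rule det_lower_triangular[of S]) (auto simp: Phi0_def)
  also have "\<dots> = 1" unfolding prod_list_diag_prod by (simp add: Phi0_def)
  finally show ?thesis .
qed

text \<open>For \<open>w \<noteq> 0\<close> and \<open>z = 1 / w\<close>, the matrix in the root condition is
\<open>z\<^sup>P \<Phi>\<^sub>0\<inverse> \<Phi>(w)\<close>, so a zero \<open>w\<close> of \<open>det \<Phi>\<close> in the closed unit disc would yield a
root \<open>z\<close> with \<open>\<bar>z\<bar> \<ge> 1\<close>.  At \<open>w = 0\<close> the determinant is that of the unit triangular
matrix \<open>\<Phi>\<^sub>0\<close>.\<close>

lemma det_Phi_poly_nonzero:
  assumes "root_condition S p \<phi>" "cmod w \<le> 1"
  shows "poly (map_poly complex_of_real (Determinant.det (Phi_poly S p \<phi>))) w \<noteq> 0"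
proof
  interpret ev: comm_ring_hom "\<lambda>p::real poly. poly (map_poly complex_of_real p) w"
    by (rule comm_ring_hom_poly_eval)
  interpret of_real: comm_ring_hom complex_of_real
    by unfold_locales auto
  define N where "N = map_mat (\<lambda>p. poly (map_poly complex_of_real p) w) (Phi_poly S p \<phi>)"
  assume "poly (map_poly complex_of_real (Determinant.det (Phi_poly S p \<phi>))) w = 0"
  then have det0: "Determinant.det N = 0" by (simp add: N_def)
  have N: "N \<in> carrier_mat S S" by (simp add: N_def Phi_poly_def)
  have N_entry: "N $$ (a, b) = complex_of_real (Phi0 S \<phi> $$ (a, b)) -
      (\<Sum>i=1..ar_order S p. complex_of_real (Phi S \<phi> i $$ (a, b)) * w ^ i)" if "a < S" "b < S" for a b
  proof -
    have "map_poly complex_of_real [:c:] = [:complex_of_real c:]" for c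
      by (rule poly_eqI) (simp add: coeff_map_poly coeff_pCons split: nat.split)
    moreover have "poly (map_poly complex_of_real (monom c i)) w = complex_of_real c * w ^ i" for c i
      by (simp add: map_poly_monom poly_monom)
    ultimately show ?thesis
      using that by (simp add: N_def Phi_poly_def ev.hom_minus ev.hom_sum)
  qed
  show False
  proof (cases "w = 0")
    case True
    have "N = map_mat complex_of_real (Phi0 S \<phi>)"
      using N N_entry by (intro eq_matI) (auto simp: Phi0_def True power_0_left)
    then have "Determinant.det N = 1" using det_Phi0[of S \<phi>] by simp
    with det0 show False by simp
  next
    case False
    define z where "z = inverse w"
    define P where "P = ar_order S p"
    define J where "J = inv_mat (Phi0 S \<phi>)"
    have P0: "Phi0 S \<phi> \<in> carrier_mat S S" by (simp add: Phi0_def)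
    have Pi: "Phi S \<phi> i \<in> carrier_mat S S" for i by (simp add: Phi_def)
    note J = inv_mat_if_det_unit(2,4)[OF P0, of 1, folded J_def]
    have J1: "J \<in> carrier_mat S S" and J2: "J * Phi0 S \<phi> = 1\<^sub>m S"
      using J by (simp_all add: det_Phi0)
    define Q where "Q = Matrix.mat S S (\<lambda>(a, b). (if a = b then z ^ P else 0) -
        (\<Sum>i=1..P. complex_of_real ((J * Phi S \<phi> i) $$ (a, b)) * z ^ (P - i)))"
    have "Q = map_mat complex_of_real J * (z ^ P \<cdot>\<^sub>m N)"
    proof (rule eq_matI)
      fix a b assume "a < dim_row (map_mat complex_of_real J * (z ^ P \<cdot>\<^sub>m N))"
        "b < dim_col (map_mat complex_of_real J * (z ^ P \<cdot>\<^sub>m N))"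
      then have ab: "a < S" "b < S" using J1 N by auto
      have entry: "complex_of_real ((J * A) $$ (a, b)) = (\<Sum>k = 0..<S. of_real (J $$ (a, k)) * of_real (A $$ (k, b)))"
        if "A \<in> carrier_mat S S" for A
        using that ab J1 by (simp add: scalar_prod_def)
      have zw: "z ^ P * w ^ i = z ^ (P - i)" if "i \<le> P" for i
        using that False by (simp add: z_def power_diff power_inverse divide_inverse)
      have "(map_mat complex_of_real J * (z ^ P \<cdot>\<^sub>m N)) $$ (a, b) = 
          (\<Sum>k = 0..<S. of_real (J $$ (a, k)) * (z ^ P * N $$ (k, b)))"
        using ab J1 N by (simp add: scalar_prod_def)
      also have "\<dots> = (\<Sum>k = 0..<S. z ^ P * (of_real (J $$ (a, k)) * of_real (Phi0 S \<phi> $$ (k, b))) -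
          (\<Sum>i=1..P. of_real (J $$ (a, k)) * of_real (Phi S \<phi> i $$ (k, b)) * (z ^ P * w ^ i)))"
        using ab by (intro sum.cong refl) 
          (simp add: N_entry P_def sum_distrib_left right_diff_distrib mult_ac)
      also have "\<dots> = z ^ P * complex_of_real ((J * Phi0 S \<phi>) $$ (a, b)) - 
          (\<Sum>k = 0..<S. \<Sum>i=1..P. of_real (J $$ (a, k)) * of_real (Phi S \<phi> i $$ (k, b)) * (z ^ P * w ^ i))"
        unfolding entry[OF P0] sum_subtractf by (simp add: sum_distrib_left)
      also have "(\<Sum>k = 0..<S. \<Sum>i=1..P. of_real (J $$ (a, k)) * of_real (Phi S \<phi> i $$ (k, b)) * (z ^ P * w ^ i)) = 
          (\<Sum>i=1..P. complex_of_real ((J * Phi S \<phi> i) $$ (a, b)) * z ^ (P - i))"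
        unfolding entry[OF Pi] by (subst sum.swap) (simp add: sum_distrib_right zw)
      finally show "Q $$ (a, b) = (map_mat complex_of_real J * (z ^ P \<cdot>\<^sub>m N)) $$ (a, b)"
        using ab unfolding J2 by (simp add: Q_def)
    qed (use J1 N in \<open>auto simp: Q_def\<close>)
    then have "Determinant.det Q = Determinant.det (map_mat complex_of_real J) * Determinant.det (z ^ P \<cdot>\<^sub>m N)"
      using J1 N by (simp add: det_mult[of _ S])
    also have "Determinant.det (z ^ P \<cdot>\<^sub>m N) = 0" using det0 by (simp add: det_smult)
    finally have "cmod z < 1"
      using assms(1) unfolding root_condition_def Q_def P_def J_def by auto
    moreover have "1 \<le> cmod z"
      using assms(2) False by (simp add: z_def norm_inverse one_le_inverse)
    ultimately show False by simp
  qed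
qed

text \<open>The inverse of the lag matrix is its polynomial adjugate divided by the determinant, which has no
zero in the closed unit disc.  All entries therefore converge beyond radius 1, and evaluation at 1
carries the two inverse laws over to \<open>\<Phi>(1)\<close>.\<close>

lemma inverse_Phi_lag:
  assumes "root_condition S p \<phi>"
  shows "inv_mat (Phi_lag S p \<phi>) \<in> carrier_mat S S"
    and "\<And>a b. a < S \<Longrightarrow> b < S \<Longrightarrow> fps_conv_radius (inv_mat (Phi_lag S p \<phi>) $$ (a, b)) > 1"
    and "inv_mat (Phi_at_one S p \<phi>) = map_mat (\<lambda>f. eval_fps f 1) (inv_mat (Phi_lag S p \<phi>))"
proof -
  interpret fp: comm_ring_hom "fps_of_poly :: real poly \<Rightarrow> real fps"
    by (rule comm_ring_hom_fps_of_poly)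
  define A where "A = Phi_poly S p \<phi>"
  define B where "B = inv_mat (Phi_lag S p \<phi>)"
  define q where "q = Determinant.det A"
  define L where "L = Phi_lag S p \<phi>"
  have A: "A \<in> carrier_mat S S" by (simp add: A_def Phi_poly_carrier)
  have L: "L \<in> carrier_mat S S" by (simp add: L_def Phi_lag_def)
  have L_eq: "L = map_mat fps_of_poly A" by (simp add: L_def A_def Phi_lag_eq)
  have det: "Determinant.det L = fps_of_poly q" by (simp add: L_eq q_def)
  have nz: "poly (map_poly complex_of_real q) w \<noteq> 0" if "cmod w \<le> 1" for w
    unfolding q_def A_def by (rule det_Phi_poly_nonzero[OF assms that])
  have "coeff q 0 \<noteq> 0"
    using nz[of 0] by (simp add: poly_0_coeff_0 coeff_map_poly)
  then have unit: "inverse (fps_of_poly q) * Determinant.det L = 1"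
    unfolding det by (intro inverse_mult_eq_1) simp
  note inv = inv_mat_if_det_unit[OF L unit, folded B_def[folded L_def]]
  show B: "B \<in> carrier_mat S S" by (rule inv)
  show rB: "fps_conv_radius (B $$ (a, b)) > 1" if "a < S" "b < S" for a b
  proof -
    have "adj_mat L $$ (a, b) = fps_of_poly (adj_mat A $$ (a, b))"
    proof -
      have "mat_delete L b a = map_mat fps_of_poly (mat_delete A b a)"
        unfolding L_eq using A by (intro eq_matI) (auto simp: mat_delete_def)
      then show ?thesis using that L A
        by (simp add: adj_mat_def cofactor_def fp.hom_mult fp.hom_power fp.hom_uminus)
    qed
    then have "B $$ (a, b) = inverse (fps_of_poly q) * fps_of_poly (adj_mat A $$ (a, b))"
      using that adj_mat(1)[OF L] by (simp add: inv(1))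
    moreover have "1 < min (fps_conv_radius (inverse (fps_of_poly q)))
        (fps_conv_radius (fps_of_poly (adj_mat A $$ (a, b))))"
      using fps_conv_radius_inverse_poly_gt_1[OF nz] by simp
    ultimately show ?thesis
      using less_le_trans[OF _ fps_conv_radius_mult] by metis
  qed
  have rL: "fps_conv_radius (L $$ (a, b)) > 1" if "a < S" "b < S" for a b
    using that A by (simp add: L_eq)
  show "inv_mat (Phi_at_one S p \<phi>) = map_mat (\<lambda>f. eval_fps f 1) B"
  proof (rule inv_mat_eqI[where n = S])
    have one: "map_mat (\<lambda>f. eval_fps f 1) (1\<^sub>m S :: real fps mat) = 1\<^sub>m S"
      by (intro eq_matI) auto
    show "Phi_at_one S p \<phi> * map_mat (\<lambda>f. eval_fps f 1) B = 1\<^sub>m S"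
      by (simp only: Phi_at_one_eq L_def[symmetric] eval_fps_mat_mult_at_1[OF L B rL rB, symmetric] inv(3) one)
    show "map_mat (\<lambda>f. eval_fps f 1) B * Phi_at_one S p \<phi> = 1\<^sub>m S"
      by (simp only: Phi_at_one_eq L_def[symmetric] eval_fps_mat_mult_at_1[OF B L rB rL, symmetric] inv(4) one)
  qed (use B in \<open>auto simp: Phi_at_one_def\<close>)
qed

section \<open>Asymptotics of the autocovariance\<close>

text \<open>The weight \<open>n + 1\<close> arises from differentiating \<open>z f(z)\<close>, which keeps the radius of
convergence.\<close>

lemma summable_weighted_coeffs:
  fixes f :: "real fps"
  assumes "fps_conv_radius f > 1"
  shows "summable (\<lambda>n. (real n + 1) * \<bar>fps_nth f n\<bar>)"
proof -
  have "fps_conv_radius (fps_deriv (fps_X * f)) > 1"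
    using assms by (intro less_le_trans[OF _ fps_conv_radius_deriv] less_le_trans[OF _ fps_conv_radius_mult]) auto
  then have "summable (\<lambda>n. norm (fps_nth (fps_deriv (fps_X * f)) n * 1 ^ n))"
    by (intro norm_summable_fps) (simp add: one_ereal_def)
  moreover have "fps_nth (fps_deriv (fps_X * f)) n = (real n + 1) * fps_nth f n" for n
    unfolding fps_deriv_nth by simp
  ultimately show ?thesis by (simp only: abs_mult real_norm_def power_one mult_1_right abs_of_nat
      abs_of_nonneg of_nat_0_le_iff add_nonneg_nonneg zero_le_one)
qed

lemma eval_fps_at_1: "eval_fps f 1 = (\<Sum>n. fps_nth f n)"
  by (simp add: eval_fps_def)

lemma frac_filter_zero: "Abs_fps (frac_coeff 0) = 1"
  by (rule fps_ext) (simp add: frac_coeff_def)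

lemma filter_coeff_asymp:
  fixes f :: "real fps"
  assumes "0 < d" "d \<le> 1" and f: "fps_conv_radius f > 1"
  shows "(\<lambda>n. fps_nth (Abs_fps (frac_coeff (- d)) * f) n / real n powr (d - 1)) \<longlonglongrightarrow> eval_fps f 1 / Gamma d"
proof -
  have "(\<lambda>n. (\<Sum>i\<le>n. fps_nth f i * frac_coeff (- d) (n - i)) / real n powr (d - 1))
      \<longlonglongrightarrow> 1 / Gamma d * (\<Sum>i. fps_nth f i)"
    using assms by (intro convolution_asymp frac_coeff_asymp summable_weighted_coeffs) auto
  moreover have "fps_nth (Abs_fps (frac_coeff (- d)) * f) n = (\<Sum>i\<le>n. fps_nth f i * frac_coeff (- d) (n - i))" for n
    by (subst mult.commute) (simp add: fps_mult_nth atLeast0AtMost)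
  ultimately show ?thesis by (simp add: eval_fps_at_1)
qed

text \<open>For \<open>d = 0\<close> the fractional part is the identity, and \<open>(n + 1) \<bar>f\<^sub>n\<bar>\<close> is bounded because it
is summable; this provides the same form of bound as for \<open>d > 0\<close>.\<close>

lemma filter_coeff_bound:
  fixes f :: "real fps"
  assumes "0 \<le> d" "d \<le> 1" and f: "fps_conv_radius f > 1"
  obtains C where "C \<ge> 0" "\<And>n. \<bar>fps_nth (Abs_fps (frac_coeff (- d)) * f) n\<bar> \<le> C * real (n + 1) powr (d - 1)"
proof (cases "d = 0")
  case True
  define C where "C = (\<Sum>n. (real n + 1) * \<bar>fps_nth f n\<bar>)"
  have C: "(real n + 1) * \<bar>fps_nth f n\<bar> \<le> C" for n
    using sum_le_suminf[OF summable_weighted_coeffs[OF f], of "{n}"] by (simp add: C_def)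
  have "\<bar>fps_nth f n\<bar> \<le> C * real (n + 1) powr (- 1)" for n
    using C[of n] by (simp add: powr_minus field_simps)
  moreover have "C \<ge> 0" using C[of 0] by (meson abs_ge_zero mult_nonneg_nonneg of_nat_0_le_iff add_nonneg_nonneg zero_le_one order_trans)
  ultimately show ?thesis using True by (intro that[of C]) (simp_all add: frac_filter_zero)
next
  case False
  with assms have "0 < d" by simp
  from powr_asymp_bound[OF filter_coeff_asymp[OF this assms(2) f]] show ?thesis using that by blast
qed

lemma filter_cross_summable:
  fixes f g :: "real fps"
  assumes d: "0 \<le> d" "d < 1 / 2" and e: "0 \<le> e" "e < 1 / 2"
    and f: "fps_conv_radius f > 1" and g: "fps_conv_radius g > 1"
  shows "summable (\<lambda>j. fps_nth (Abs_fps (frac_coeff (- d)) * f) j *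
      fps_nth (Abs_fps (frac_coeff (- e)) * g) (j + n))" (is "summable (\<lambda>j. ?x j * ?y (j + n))")
proof -
  obtain C where C: "C \<ge> 0" "\<And>n. \<bar>?x n\<bar> \<le> C * real (n + 1) powr (d - 1)"
    using filter_coeff_bound[OF d(1) _ f] d by auto
  obtain K where K: "K \<ge> 0" "\<And>n. \<bar>?y n\<bar> \<le> K * real (n + 1) powr (e - 1)"
    using filter_coeff_bound[OF e(1) _ g] e by auto
  show ?thesis
    by (rule cross_sum_summable[OF C(2) K(2)]) (use d e in auto)
qed

text \<open>The three regimes share one formula.  For \<open>e = 0\<close> the constant vanishes, since
\<open>1 / Gamma 0 = 0\<close>, and the cross-sum is indeed of smaller order.  For \<open>d = 0 < e\<close> the Gamma
quotient reduces to \<open>1 / Gamma e\<close>.  For \<open>d, e > 0\<close> it is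
\<open>Beta d (1 - d - e) / (Gamma d * Gamma e)\<close>.\<close>

lemma filter_cross_asymp:
  fixes f g :: "real fps"
  assumes d: "0 \<le> d" "d < 1 / 2" and e: "0 \<le> e" "e < 1 / 2"
    and f: "fps_conv_radius f > 1" and g: "fps_conv_radius g > 1"
  shows "(\<lambda>n. (\<Sum>j. fps_nth (Abs_fps (frac_coeff (- d)) * f) j *
      fps_nth (Abs_fps (frac_coeff (- e)) * g) (j + n)) / real n powr (d + e - 1))
    \<longlonglongrightarrow> Gamma (1 - d - e) / (Gamma e * Gamma (1 - e)) * (eval_fps f 1 * eval_fps g 1)"
    (is "(\<lambda>n. (\<Sum>j. ?x j * ?y (j + n)) / _) \<longlonglongrightarrow> _")
proof -
  consider (short) "e = 0" | (short_long) "d = 0" "e > 0" | (long_long) "d > 0" "e > 0"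
    using d e by linarith
  then show ?thesis
  proof cases
    case short
    obtain C where C: "C \<ge> 0" "\<And>n. \<bar>?x n\<bar> \<le> C * real (n + 1) powr (d - 1)"
      using filter_coeff_bound[OF d(1) _ f] d by auto
    have "\<bar>?x n\<bar> \<le> C" for n
    proof -
      have "real (n + 1) powr (d - 1) \<le> real (n + 1) powr 0"
        using d by (intro powr_mono) auto
      then have "real (n + 1) powr (d - 1) \<le> 1" by simp
      then show ?thesis using C(2)[of n] mult_left_mono[OF _ C(1)] by fastforce
    qed
    then have "(\<lambda>n. (\<Sum>j. ?x j * fps_nth g (j + n)) / real n powr (d + e - 1)) \<longlonglongrightarrow> 0"
      using d short by (intro cross_sum_bounded_short summable_weighted_coeffs g) auto
    then show ?thesis using short by (simp add: frac_filter_zero)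
  next
    case short_long
    have "summable (\<lambda>n. \<bar>fps_nth f n\<bar>)"
      by (rule summable_comparison_test[OF _ summable_weighted_coeffs[OF f]]) (auto simp: algebra_simps)
    then have "(\<lambda>n. (\<Sum>j. fps_nth f j * ?y (j + n)) / real n powr (e - 1)) 
        \<longlonglongrightarrow> eval_fps g 1 / Gamma e * (\<Sum>j. fps_nth f j)"
      using e short_long by (intro cross_sum_short_long filter_coeff_asymp g) auto
    moreover have "Gamma (1 - e) > 0" using e by (intro Gamma_real_pos) simp
    then have "Gamma (1 - e) \<noteq> 0" by simp
    ultimately show ?thesis using short_long by (simp add: frac_filter_zero eval_fps_at_1 mult_ac)
  next
    case long_long
    have "(\<lambda>n. (\<Sum>j. ?x j * ?y (j + n)) / real n powr (d + e - 1))
        \<longlonglongrightarrow> eval_fps f 1 / Gamma d * (eval_fps g 1 / Gamma e) * Beta d (1 - d - e)"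
      using d e long_long by (intro cross_sum_long_long filter_coeff_asymp f g) auto
    moreover have "eval_fps f 1 / Gamma d * (eval_fps g 1 / Gamma e) * Beta d (1 - d - e) = 
        Gamma (1 - d - e) / (Gamma e * Gamma (1 - e)) * (eval_fps f 1 * eval_fps g 1)"
      using Gamma_real_pos[OF long_long(1)] by (simp add: Beta_def)
    ultimately show ?thesis by simp
  qed
qed

theorem corollary2:
  fixes M :: "'a measure"
    and S p s \<nu> :: nat
    and \<tau> :: int
    and \<phi> :: "int \<Rightarrow> nat \<Rightarrow> real"
    and D \<sigma> :: "int \<Rightarrow> real"
    and u Y :: "int \<Rightarrow> 'a \<Rightarrow> real"
  assumes "prob_space M"
    and "S \<ge> 1" and "p \<ge> 1"
    and "white_noise M \<sigma> u"
    and "periodic S (\<lambda>t. (\<sigma> t)\<^sup>2)" and "periodic S D" and "periodic S \<phi>"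
    and "\<forall>t i. i > p \<longrightarrow> \<phi> t i = 0"
    and "root_condition S p \<phi>"
    and "\<forall>s\<in>{1..S}. 0 \<le> D (int s) \<and> D (int s) < 1 / 2"
    and "model_equation M S p \<phi> D u Y"
    and "ma_solution M S p \<phi> D u Y"
    and "s \<in> {1..S}" and "\<nu> \<in> {0..S - 1}"
  shows
    "let \<delta> = (if s + \<nu> \<le> S then 0 else 1);
         r = s + \<nu> - S * \<delta>;
         \<gamma> = (\<lambda>j. covariance M (Y (int S * \<tau> + int s)) (Y (int S * \<tau> + int s + int j)));
         P = inv_mat (Phi_at_one S p \<phi>)
     in (\<lambda>h. \<gamma> (h * S + \<nu>) / real (h + \<delta>) powr (D (int s) + D (int r) - 1))
          \<longlonglongrightarrow> Gamma (1 - D (int s) - D (int r)) / (Gamma (D (int r)) * Gamma (1 - D (int r)))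
                * scalar_prod (row P (s - 1)) (Omega S \<sigma> *\<^sub>v row P (r - 1))"
proof -
  define \<delta> :: nat where "\<delta> = (if s + \<nu> \<le> S then 0 else 1)"
  define r where "r = s + \<nu> - S * \<delta>"
  define \<gamma> where "\<gamma> = (\<lambda>j. covariance M (Y (int S * \<tau> + int s)) (Y (int S * \<tau> + int s + int j)))"
  define P where "P = inv_mat (Phi_at_one S p \<phi>)"
  define B where "B = inv_mat (Phi_lag S p \<phi>)"
  \<comment> \<open>weights with which the innovations of season \<open>k\<close> enter the process in season \<open>a\<close>\<close>
  define \<psi> where "\<psi> = (\<lambda>a k j. fps_nth (Abs_fps (frac_coeff (- D (int a))) * B $$ (a - 1, k - 1)) j)"
  note B = inverse_Phi_lag[OF assms(9), folded B_def P_def]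
  have s: "1 \<le> s" "s \<le> S" using assms by auto
  have r: "1 \<le> r" "r \<le> S" and split: "s + \<nu> = r + S * \<delta>"
    using assms by (auto simp: r_def \<delta>_def)
  have Ds: "0 \<le> D (int s)" "D (int s) < 1 / 2" and Dr: "0 \<le> D (int r)" "D (int r) < 1 / 2"
    using assms(10) s r by auto
  have "(nabla_inv_lag S D * B) $$ (a - 1, k - 1) = Abs_fps (frac_coeff (- D (int a))) * B $$ (a - 1, k - 1)"
    if "a \<in> {1..S}" "k \<in> {1..S}" for a k
  proof -
    have "int (a - 1) + 1 = int a" "a - 1 < S" "k - 1 < S" using that by auto
    then show ?thesis
      using that unfolding nabla_inv_lag_def mat_diag_mult_left[OF B(1)] by simp
  qed
  then have ma: "ms_sums M (\<lambda>j \<omega>. \<Sum>k=1..S. \<psi> a k j * u (int k + int S * (t - int j)) \<omega>)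
      (Y (int a + int S * t))" if "a \<in> {1..S}" for a t
    using assms(12) that unfolding ma_solution_def Let_def B_def[symmetric] \<psi>_def by simp
  define G where "G = (\<lambda>n. \<Sum>k=1..S. (\<sigma> (int k))\<^sup>2 * (\<Sum>j. \<psi> s k j * \<psi> r k (j + n)))"
  \<comment> \<open>Time \<open>S \<tau> + s + h S + \<nu>\<close> is season \<open>r\<close> of block \<open>\<tau> + h + \<delta>\<close>, so the covariance depends
    on the block lag \<open>h + \<delta>\<close>.\<close>
  have \<gamma>: "\<gamma> (h * S + \<nu>) = G (h + \<delta>)" for h
  proof -
    have "int S * \<tau> + int s + int (h * S + \<nu>) = int r + int S * (\<tau> + int (h + \<delta>))"
      using arg_cong[OF split, of int] by (simp add: algebra_simps)
    then have \<gamma>_eq: "\<gamma> (h * S + \<nu>) = 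
        covariance M (Y (int s + int S * \<tau>)) (Y (int r + int S * (\<tau> + int (h + \<delta>))))"
      by (simp only: \<gamma>_def add.commute)
    have "(\<lambda>j. \<Sum>k=1..S. (\<sigma> (int k))\<^sup>2 * (\<psi> s k j * \<psi> r k (j + (h + \<delta>)))) sums \<gamma> (h * S + \<nu>)"
      unfolding \<gamma>_eq using s r by (intro moving_average_covariance[OF assms(1,4) ma ma assms(5)]) auto
    moreover have "(\<lambda>j. \<Sum>k=1..S. (\<sigma> (int k))\<^sup>2 * (\<psi> s k j * \<psi> r k (j + (h + \<delta>)))) sums G (h + \<delta>)"
      unfolding G_def
    proof (intro sums_sum sums_mult summable_sums)
      fix k assume "k \<in> {1..S}"
      then show "summable (\<lambda>j. \<psi> s k j * \<psi> r k (j + (h + \<delta>)))"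
        unfolding \<psi>_def using Ds Dr s r by (intro filter_cross_summable B) auto
    qed
    ultimately show ?thesis by (rule sums_unique2)
  qed
  define K where "K = Gamma (1 - D (int s) - D (int r)) / (Gamma (D (int r)) * Gamma (1 - D (int r)))"
  have "(\<lambda>n. \<Sum>k=1..S. (\<sigma> (int k))\<^sup>2 * 
      ((\<Sum>j. \<psi> s k j * \<psi> r k (j + n)) / real n powr (D (int s) + D (int r) - 1)))
    \<longlonglongrightarrow> (\<Sum>k=1..S. (\<sigma> (int k))\<^sup>2 * 
      (K * (eval_fps (B $$ (s - 1, k - 1)) 1 * eval_fps (B $$ (r - 1, k - 1)) 1)))"
    unfolding \<psi>_def K_def using Ds Dr s r
    by (intro tendsto_sum tendsto_mult tendsto_const filter_cross_asymp B) auto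
  moreover have "(\<Sum>k=1..S. (\<sigma> (int k))\<^sup>2 * 
      ((\<Sum>j. \<psi> s k j * \<psi> r k (j + n)) / real n powr (D (int s) + D (int r) - 1))) =
      G n / real n powr (D (int s) + D (int r) - 1)" for n
    by (simp add: G_def sum_divide_distrib)
  moreover have "(\<Sum>k=1..S. (\<sigma> (int k))\<^sup>2 * 
      (K * (eval_fps (B $$ (s - 1, k - 1)) 1 * eval_fps (B $$ (r - 1, k - 1)) 1))) = 
      K * scalar_prod (row P (s - 1)) (Omega S \<sigma> *\<^sub>v row P (r - 1))"
  proof -
    have \<Omega>: "(Omega S \<sigma> *\<^sub>v row P (r - 1)) $ k = (\<sigma> (int k + 1))\<^sup>2 * P $$ (r - 1, k)" if "k < S" for k
    proof -
      have "(Omega S \<sigma> *\<^sub>v row P (r - 1)) $ k =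
          (\<Sum>i = 0..<S. (if k = i then (\<sigma> (int i + 1))\<^sup>2 else 0) * P $$ (r - 1, i))"
        using that r B(1) by (simp add: Omega_def mat_diag_def scalar_prod_def B(3))
      also have "\<dots> = (\<Sum>i = 0..<S. if k = i then (\<sigma> (int i + 1))\<^sup>2 * P $$ (r - 1, i) else 0)"
        by (intro sum.cong refl) simp
      also have "\<dots> = (\<sigma> (int k + 1))\<^sup>2 * P $$ (r - 1, k)" using that by simp
      finally show ?thesis .
    qed
    have "scalar_prod (row P (s - 1)) (Omega S \<sigma> *\<^sub>v row P (r - 1)) = 
        (\<Sum>k = 0..<S. P $$ (s - 1, k) * ((\<sigma> (int k + 1))\<^sup>2 * P $$ (r - 1, k)))"
    proof -
      have "dim_vec (Omega S \<sigma> *\<^sub>v row P (r - 1)) = S" by (simp add: Omega_def mat_diag_def)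
      then show ?thesis
        using s B(1) \<Omega> by (auto simp: scalar_prod_def B(3) intro!: sum.cong)
    qed
    also have "\<dots> = (\<Sum>k = 1..S. P $$ (s - 1, k - 1) * ((\<sigma> (int k))\<^sup>2 * P $$ (r - 1, k - 1)))"
      by (rule sum.reindex_bij_witness[of _ "\<lambda>k. k - 1" Suc]) (auto simp: add.commute)
    also have "\<dots> = (\<Sum>k=1..S. (\<sigma> (int k))\<^sup>2 * 
      (eval_fps (B $$ (s - 1, k - 1)) 1 * eval_fps (B $$ (r - 1, k - 1)) 1))"
      using s r B(1) by (intro sum.cong refl) (auto simp: B(3))
    finally show ?thesis by (simp add: sum_distrib_left mult_ac)
  qed
  ultimately have lim: "(\<lambda>n. G n / real n powr (D (int s) + D (int r) - 1)) \<longlonglongrightarrow> 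
      K * scalar_prod (row P (s - 1)) (Omega S \<sigma> *\<^sub>v row P (r - 1))" by simp
  have "(\<lambda>h. \<gamma> (h * S + \<nu>) / real (h + \<delta>) powr (D (int s) + D (int r) - 1)) \<longlonglongrightarrow> 
      K * scalar_prod (row P (s - 1)) (Omega S \<sigma> *\<^sub>v row P (r - 1))"
    unfolding \<gamma> by (rule LIMSEQ_ignore_initial_segment[OF lim])
  then show ?thesis
    unfolding Let_def \<delta>_def[symmetric] r_def[symmetric] P_def[symmetric]
    by (simp only: K_def \<gamma>_def)
qed

end
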